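(* For every $g\ge1$ and every polynomial $p$ with complex coefficients of degree at most $2$, $$\mathcal D^pZ_V=0,$$ where $Z_V$ is the genus $g$ formal partition function of $V$ and $$\mathcal D^p=\sum_{a\in\mathcal I}\left(p(w_a)\partial_{w_a}+p^{(1)}(w_a)\rho_a\partial_{\rho_a}+p^{(2)}(w_a)\rho_a\partial_{w_{-a}}\right).$$
   Context: $V=(V,Y,\mathbf 1,\omega)$ is a simple vertex operator algebra over $\mathbb C$ of strong CFT type ($V=\bigoplus_{n\ge0}V_n$, $\dim V_n<\infty$, $V_0=\mathbb C\mathbf 1$, $L(1)V_1=0$), isomorphic to its contragredient module $V'$. $Y(\omega,z)=\sum_nL(n)z^{-n-2}$. $\langle\cdot,\cdot\rangle$ is the unique non-degenerate invariant bilinear form on $V$ with $\langle\mathbf 1,\mathbf 1\rangle=1$: $\langle Y(u,z)v,w\rangle=\langle v,Y(e^{zL(1)}(-z^{-2})^{L(0)}u,z^{-1})w\rangle$. $Z^{(0)}(v_1,y_1;\ldots;v_n,y_n)=\langle\mathbf 1,Y(v_1,y_1)\cdots Y(v_n,y_n)\mathbf 1\rangle$, extended to a rational function of the $y_k$. $\mathcal I=\{\pm1,\ldots,\pm g\}$; $w_a$ ($a\in\mathcal I$), $\rho_1,\ldots,\rho_g$ are formal variables, $\rho_{-a}:=\rho_a$ (so $\partial_{\rho_{-a}}=\partial_{\rho_a}$). For each $a=1,\ldots,g$, $\{b_a\}$ is a homogeneous basis of $V$, $\{\overline b_a\}$ its $\langle\cdot,\cdot\rangle$-dual basis, $b_{-a}=\rho_a^{\mathrm{wt}(b_a)}\overline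 b_a$. The genus $g$ partition function is the formal series in $\rho_1,\ldots,\rho_g$ $$Z_V=\sum_{b_1,\ldots,b_g}Z^{(0)}(b_1,w_1;b_{-1},w_{-1};\ldots;b_g,w_g;b_{-g},w_{-g}).$$ $p^{(i)}(x)=\frac1{i!}\frac{d^ip}{dx^i}(x)$. *)

theory Defs
  imports
    Complex_Main
    "HOL-Library.Poly_Mapping"
    "HOL-Library.Groups_Big_Fun"
    "HOL-Library.FuncSet"
    "HOL-Computational_Algebra.Polynomial"
    "HOL-Computational_Algebra.Fraction_Field"
begin

section \<open>Vertex operator algebras\<close>

text \<open>\<open>mode V u n v\<close> is \<open>u\<^sub>n v\<close>, where \<open>Y(u,z) = \<Sum>\<^sub>n u\<^sub>n z\<^sup>-\<^sup>n\<^sup>-\<^sup>1\<close>.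
  The underlying vector space is the whole type \<open>'v\<close>.\<close>

record 'v voa_data =
  vscale :: "complex \<Rightarrow> 'v \<Rightarrow> 'v"
  mode :: "'v \<Rightarrow> int \<Rightarrow> 'v \<Rightarrow> 'v"
  vac :: 'v
  conformal :: 'v

definition L :: "'v voa_data \<Rightarrow> int \<Rightarrow> 'v \<Rightarrow> 'v" where
  "L V n v = mode V (conformal V) (n + 1) v"

definition wt_space :: "'v voa_data \<Rightarrow> int \<Rightarrow> 'v set" where
  "wt_space V n = {v. L V 0 v = vscale V (of_int n) v}"

text \<open>All sums in the Borcherds identity (the component form of the Jacobi identity) are finite
  by \<open>truncation\<close>. The sum of the weight spaces is direct since they are eigenspaces of \<open>L(0)\<close>.\<close>

locale vertex_operator_algebra = vector_space "vscale V"
  for V :: "('v :: ab_group_add) voa_data" +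
  assumes mode_linear_left: "Vector_Spaces.linear (vscale V) (vscale V) (\<lambda>u. mode V u n v)"
    and mode_linear_right: "Vector_Spaces.linear (vscale V) (vscale V) (\<lambda>v. mode V u n v)"
    and truncation: "\<exists>N. \<forall>n\<ge>N. mode V u n v = 0"
    and vacuum: "mode V (vac V) n v = (if n = -1 then v else 0)"
    and creation: "mode V u (-1) (vac V) = u" "n \<ge> 0 \<Longrightarrow> mode V u n (vac V) = 0"
    and borcherds:
      "Sum_any (\<lambda>i::nat. vscale V (of_int m gchoose i)
          (mode V (mode V u (q + int i) v) (m + n - int i) w)) =
       Sum_any (\<lambda>i::nat. vscale V ((-1) ^ i * (of_int q gchoose i))
          (mode V u (m + q - int i) (mode V v (n + int i) w))) -
       Sum_any (\<lambda>i::nat. vscale V ((-1) ^ i * (-1) powi q * (of_int q gchoose i))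
          (mode V v (n + q - int i) (mode V u (m + int i) w)))"
    and virasoro: "\<exists>c. \<forall>m n v. L V m (L V n v) - L V n (L V m v) =
       vscale V (of_int (m - n)) (L V (m + n) v) +
       (if m + n = 0 then vscale V (of_int (m ^ 3 - m) / 12 * c) v else 0)"
    and translation: "mode V (L V (-1) u) n v = vscale V (- of_int n) (mode V u (n - 1) v)"
    and grading: "span (\<Union>n. wt_space V n) = UNIV"
    and finite_dim: "\<exists>S. finite S \<and> wt_space V n = span S"
    and bounded_below: "\<exists>N. \<forall>n<N. wt_space V n = {0}"

text \<open>\<open>opposite_mode V k u n\<close> is the coefficient of \<open>z\<^sup>-\<^sup>n\<^sup>-\<^sup>1\<close> in
  \<open>Y(exp(z L(1)) (-z\<^sup>-\<^sup>2)\<^bsup>L(0)\<^esup> u, z\<^sup>-\<^sup>1)\<close> for \<open>u\<close> of weight \<open>k\<close>; since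
  \<open>(-z\<^sup>-\<^sup>2)\<^bsup>L(0)\<^esup> u = (-1)\<^sup>k z\<^sup>-\<^sup>2\<^sup>k u\<close>, this is
  \<open>(-1)\<^sup>k \<Sum>\<^sub>j (L(1)\<^sup>j u)\<^bsub>2k-n-2-j\<^esub> / j!\<close>. As homogeneous vectors span \<open>V\<close>, identities
  linear in \<open>u\<close> need only be imposed for homogeneous \<open>u\<close>.\<close>

definition opposite_mode ::
    "('v :: ab_group_add) voa_data \<Rightarrow> int \<Rightarrow> 'v \<Rightarrow> int \<Rightarrow> 'v \<Rightarrow> 'v" where
  "opposite_mode V k u n w = vscale V ((-1) powi k)
     (Sum_any (\<lambda>j::nat. vscale V (1 / fact j) (mode V ((L V 1 ^^ j) u) (2 * k - n - 2 - int j) w)))"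

definition nondegenerate :: "('v::zero \<Rightarrow> 'v \<Rightarrow> complex) \<Rightarrow> bool" where
  "nondegenerate B \<longleftrightarrow>
     (\<forall>u. (\<forall>v. B u v = 0) \<longrightarrow> u = 0) \<and> (\<forall>v. (\<forall>u. B u v = 0) \<longrightarrow> v = 0)"

context vertex_operator_algebra
begin

definition simple :: bool where
  "simple \<longleftrightarrow> (\<exists>v::'v. v \<noteq> 0) \<and>
     (\<forall>I. subspace I \<and> (\<forall>u n. \<forall>v\<in>I. mode V u n v \<in> I) \<longrightarrow> I = {0} \<or> I = UNIV)"

definition strong_CFT_type :: bool where
  "strong_CFT_type \<longleftrightarrow> (\<forall>n<0. wt_space V n = {0}) \<and> wt_space V 0 = span {vac V} \<and>
     (\<forall>v\<in>wt_space V 1. L V 1 v = 0)"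

text \<open>The graded dual \<open>\<Oplus>\<^sub>n V\<^sub>n\<^sup>*\<close>, as functionals on \<open>V\<close> vanishing on almost all \<open>V\<^sub>n\<close>;
  it carries the contragredient module \<open>V'\<close>.\<close>

definition graded_dual :: "('v \<Rightarrow> complex) set" where
  "graded_dual = {f. Vector_Spaces.linear (vscale V) (*) f \<and>
     finite {n. \<exists>v\<in>wt_space V n. f v \<noteq> 0}}"

definition self_contragredient :: bool where
  "self_contragredient \<longleftrightarrow> (\<exists>\<phi> :: 'v \<Rightarrow> 'v \<Rightarrow> complex.
     bij_betw \<phi> UNIV graded_dual \<and>
     (\<forall>x y w. \<phi> (x + y) w = \<phi> x w + \<phi> y w) \<and>
     (\<forall>c x w. \<phi> (vscale V c x) w = c * \<phi> x w) \<and>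
     (\<forall>k. \<forall>u\<in>wt_space V k. \<forall>n v w. \<phi> (mode V u n v) w = \<phi> v (opposite_mode V k u n w)))"

definition bilinear_form :: "('v \<Rightarrow> 'v \<Rightarrow> complex) \<Rightarrow> bool" where
  "bilinear_form B \<longleftrightarrow>
     (\<forall>v. Vector_Spaces.linear (vscale V) (*) (\<lambda>u. B u v)) \<and>
     (\<forall>u. Vector_Spaces.linear (vscale V) (*) (\<lambda>v. B u v))"

definition invariant :: "('v \<Rightarrow> 'v \<Rightarrow> complex) \<Rightarrow> bool" where
  "invariant B \<longleftrightarrow> (\<forall>k. \<forall>u\<in>wt_space V k. \<forall>n v w.
     B (mode V u n v) w = B v (opposite_mode V k u n w))"

definition homogeneous_basis :: "'v set \<Rightarrow> bool" where
  "homogeneous_basis S \<longleftrightarrow> S \<subseteq> (\<Union>n. wt_space V n) \<and> independent S \<and> span S = UNIV"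

end

section \<open>Rational functions\<close>

text \<open>Polynomials and rational functions over the complex numbers in variables indexed by the
  integers; the variable with index \<open>a\<close> plays the role of \<open>w\<^sub>a\<close>.\<close>

type_synonym mpoly = "(int \<Rightarrow>\<^sub>0 nat) \<Rightarrow>\<^sub>0 complex"

type_synonym ratfun = "mpoly fract"

definition const :: "complex \<Rightarrow> ratfun" where
  "const c = Fract (Poly_Mapping.single 0 c) 1"

definition var :: "int \<Rightarrow> ratfun" where
  "var a = Fract (Poly_Mapping.single (Poly_Mapping.single a 1) 1) 1"

definition mpoly_pderiv :: "int \<Rightarrow> mpoly \<Rightarrow> mpoly" where
  "mpoly_pderiv a P = (\<Sum>k\<in>Poly_Mapping.keys P. Poly_Mapping.single (k - Poly_Mapping.single a 1)
     (of_nat (Poly_Mapping.lookup k a) * Poly_Mapping.lookup P k))"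

lemma mpoly_pderiv_superset:
  assumes "finite A" "Poly_Mapping.keys P \<subseteq> A"
  shows "mpoly_pderiv a P = (\<Sum>k\<in>A. Poly_Mapping.single (k - Poly_Mapping.single a 1)
     (of_nat (Poly_Mapping.lookup k a) * Poly_Mapping.lookup P k))"
  unfolding mpoly_pderiv_def using assms
  by (intro sum.mono_neutral_left) (auto simp: in_keys_iff)

lemma mpoly_pderiv_add: "mpoly_pderiv a (P + Q) = mpoly_pderiv a P + mpoly_pderiv a Q"
proof -
  have "Poly_Mapping.keys (P + Q) \<subseteq> Poly_Mapping.keys P \<union> Poly_Mapping.keys Q" by (rule Poly_Mapping.keys_add)
  then show ?thesis
    by (simp add: mpoly_pderiv_superset[of "Poly_Mapping.keys P \<union> Poly_Mapping.keys Q"] lookup_add algebra_simps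
      sum.distrib single_add)
qed

lemma mpoly_pderiv_single:
  "mpoly_pderiv a (Poly_Mapping.single k c) =
    Poly_Mapping.single (k - Poly_Mapping.single a 1) (of_nat (Poly_Mapping.lookup k a) * c)"
  by (subst mpoly_pderiv_superset[of "{k}"]) auto

lemma mpoly_pderiv_zero: "mpoly_pderiv a 0 = 0"
  by (simp add: mpoly_pderiv_def)

lemma single_mult_eq:
  fixes k l :: "int \<Rightarrow>\<^sub>0 nat"
  shows "Poly_Mapping.single (k + l - Poly_Mapping.single a 1) (of_nat (Poly_Mapping.lookup k a) * c) =
   (Poly_Mapping.single ((k - Poly_Mapping.single a 1) + l) (of_nat (Poly_Mapping.lookup k a) * c :: complex))"
proof (cases "Poly_Mapping.lookup k a = 0")
  case False
  then have "k + l - Poly_Mapping.single a 1 = (k - Poly_Mapping.single a 1) + l"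
    by (intro poly_mapping_eqI) (auto simp: lookup_add lookup_minus lookup_single when_def)
  then show ?thesis by simp
qed simp

lemma mpoly_pderiv_mult_single:
  "mpoly_pderiv a (Poly_Mapping.single k c * Poly_Mapping.single l d) =
   mpoly_pderiv a (Poly_Mapping.single k c) * Poly_Mapping.single l d +
   Poly_Mapping.single k c * mpoly_pderiv a (Poly_Mapping.single l d)"
  using single_mult_eq[of k l a "c * d"] single_mult_eq[of l k a "c * d"]
  by (simp add: mpoly_pderiv_single mult_single lookup_add single_add algebra_simps)

lemma mpoly_expand: "(P :: mpoly) = (\<Sum>k\<in>Poly_Mapping.keys P. Poly_Mapping.single k (Poly_Mapping.lookup P k))"
  by (rule poly_mapping_eqI)
     (auto simp: lookup_sum lookup_single when_def in_keys_iff cong: if_cong)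

lemma mpoly_pderiv_sum: "mpoly_pderiv a (sum f A) = (\<Sum>x\<in>A. mpoly_pderiv a (f x))"
  by (induction A rule: infinite_finite_induct) (auto simp: mpoly_pderiv_add mpoly_pderiv_zero)

lemma mpoly_pderiv_mult:
  "mpoly_pderiv a (P * Q) = mpoly_pderiv a P * Q + P * mpoly_pderiv a Q"
proof -
  let ?m = "\<lambda>R k. Poly_Mapping.single k (Poly_Mapping.lookup R k) :: mpoly"
  have "P * Q = (\<Sum>k\<in>Poly_Mapping.keys P. ?m P k) * (\<Sum>l\<in>Poly_Mapping.keys Q. ?m Q l)"
    by (simp only: mpoly_expand[symmetric])
  also have "mpoly_pderiv a \<dots> =
     (\<Sum>k\<in>Poly_Mapping.keys P. mpoly_pderiv a (?m P k)) * (\<Sum>l\<in>Poly_Mapping.keys Q. ?m Q l) +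
     (\<Sum>k\<in>Poly_Mapping.keys P. ?m P k) * (\<Sum>l\<in>Poly_Mapping.keys Q. mpoly_pderiv a (?m Q l))"
    by (simp add: sum_product mpoly_pderiv_sum mpoly_pderiv_mult_single sum.distrib)
  also have "\<dots> = mpoly_pderiv a P * Q + P * mpoly_pderiv a Q"
    by (simp only: mpoly_pderiv_sum[symmetric] mpoly_expand[symmetric])
  finally show ?thesis .
qed

lemma quotient_rule_alg:
  fixes P Q P' Q' dP dQ dP' dQ' :: "'a :: comm_ring_1"
  assumes "P * Q' = P' * Q" and "dP * Q' + P * dQ' = dP' * Q + P' * dQ"
  shows "(dP * Q - P * dQ) * (Q' * Q') = (dP' * Q' - P' * dQ') * (Q * Q)"
proof -
  have "(dP * Q - P * dQ) * (Q' * Q') - (dP' * Q' - P' * dQ') * (Q * Q) =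
     ((dP * Q' + P * dQ') - (dP' * Q + P' * dQ)) * (Q * Q') -
     (P * Q' - P' * Q) * (Q' * dQ + Q * dQ')"
    by (simp add: algebra_simps)
  then show ?thesis using assms by simp
qed

text \<open>The partial derivative of a rational function, by the quotient rule.\<close>

lift_definition pdiff :: "int \<Rightarrow> ratfun \<Rightarrow> ratfun" is
  "\<lambda>a (P, Q). (mpoly_pderiv a P * Q - P * mpoly_pderiv a Q, Q * Q)"
proof (clarsimp, goal_cases)
  case (1 a P Q P' Q')
  from 1 have "mpoly_pderiv a (P * Q') = mpoly_pderiv a (P' * Q)" by simp
  then have "mpoly_pderiv a P * Q' + P * mpoly_pderiv a Q' =
      mpoly_pderiv a P' * Q + P' * mpoly_pderiv a Q"
    by (simp only: mpoly_pderiv_mult)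
  with 1 show ?case by (intro quotient_rule_alg) simp_all
qed

lemma pdiff_Fract: "Q \<noteq> 0 \<Longrightarrow>
  pdiff a (Fract P Q) = Fract (mpoly_pderiv a P * Q - P * mpoly_pderiv a Q) (Q * Q)"
  by transfer (simp only: fractrel_iff if_False prod.case fst_conv snd_conv mult_eq_0_iff
    disj_not1 de_Morgan_disj simp_thms)

section \<open>Genus zero correlation functions\<close>

text \<open>A formal Laurent series, infinite in all directions, in the variables of \<^typ>\<open>mpoly\<close>, given by
  its coefficients. These series form a module over the polynomials.\<close>

type_synonym formal_series = "(int \<Rightarrow> int) \<Rightarrow> complex"

definition mpoly_act :: "mpoly \<Rightarrow> formal_series \<Rightarrow> formal_series" where
  "mpoly_act P F m = (\<Sum>k\<in>Poly_Mapping.keys P.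
     Poly_Mapping.lookup P k * F (\<lambda>i. m i - int (Poly_Mapping.lookup k i)))"

definition one_series :: formal_series where
  "one_series m = (if m = (\<lambda>_. 0) then 1 else 0)"

text \<open>The rational function \<open>P/Q\<close> with \<open>Q \<cdot> F = P\<close>. By \<open>rational_extension_eqI\<close> below there is at
  most one. If \<open>F\<close> is the series of a matrix element
  \<open>\<langle>\<one>, Y(v\<^sub>1,y\<^sub>1) \<cdots> Y(v\<^sub>n,y\<^sub>n)\<one>\<rangle>\<close>, then \<open>F\<close> and all
  polynomials lie in the integral domain of Laurent series in
  \<open>y\<^sub>2/y\<^sub>1, \<dots>, y\<^sub>n/y\<^sub>n\<^sub>-\<^sub>1\<close> (exponents bounded below) over the Laurent polynomials in \<open>y\<^sub>1\<close>,
  so \<open>Q \<cdot> F = P\<close> says that \<open>F\<close> is the expansion of \<open>P/Q\<close> in the domain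
  \<open>|y\<^sub>1| > \<dots> > |y\<^sub>n| > 0\<close>.\<close>

definition rational_extension :: "formal_series \<Rightarrow> ratfun" where
  "rational_extension F = (THE R. \<exists>P Q. Q \<noteq> 0 \<and> R = Fract P Q \<and>
     mpoly_act Q F = mpoly_act P one_series)"

lemma mpoly_act_superset:
  assumes "finite A" "Poly_Mapping.keys P \<subseteq> A"
  shows "mpoly_act P F m = (\<Sum>k\<in>A. Poly_Mapping.lookup P k * F (\<lambda>i. m i - int (Poly_Mapping.lookup k i)))"
  unfolding mpoly_act_def using assms
  by (intro sum.mono_neutral_left) (auto simp: in_keys_iff)

lemma mpoly_act_add: "mpoly_act (P + Q) F m = mpoly_act P F m + mpoly_act Q F m"
proof -
  have "Poly_Mapping.keys (P + Q) \<subseteq> Poly_Mapping.keys P \<union> Poly_Mapping.keys Q"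
    by (rule Poly_Mapping.keys_add)
  then show ?thesis
    by (simp add: mpoly_act_superset[of "Poly_Mapping.keys P \<union> Poly_Mapping.keys Q"] lookup_add
      algebra_simps sum.distrib)
qed

lemma mpoly_act_sum: "mpoly_act (sum f A) F m = (\<Sum>x\<in>A. mpoly_act (f x) F m)"
proof -
  have "mpoly_act 0 F m = 0" by (simp add: mpoly_act_def)
  then show ?thesis
    by (induction A rule: infinite_finite_induct) (simp_all add: mpoly_act_add)
qed

lemma mpoly_act_single: "mpoly_act (Poly_Mapping.single k c) F m =
   c * F (\<lambda>i. m i - int (Poly_Mapping.lookup k i))"
  by (subst mpoly_act_superset[of "{k}"]) auto

lemma mpoly_act_mult: "mpoly_act (P * Q) F = mpoly_act P (mpoly_act Q F)"
proof
  fix m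
  have "P * Q = (\<Sum>k\<in>Poly_Mapping.keys P. Poly_Mapping.single k (Poly_Mapping.lookup P k)) *
     (\<Sum>l\<in>Poly_Mapping.keys Q. Poly_Mapping.single l (Poly_Mapping.lookup Q l))"
    by (simp only: mpoly_expand[symmetric])
  then have "mpoly_act (P * Q) F m = (\<Sum>k\<in>Poly_Mapping.keys P. \<Sum>l\<in>Poly_Mapping.keys Q.
     Poly_Mapping.lookup P k * Poly_Mapping.lookup Q l *
     F (\<lambda>i. m i - int (Poly_Mapping.lookup (k + l) i)))"
    by (simp add: sum_product mult_single mpoly_act_sum mpoly_act_single)
  also have "\<dots> = mpoly_act P (mpoly_act Q F) m"
    by (simp add: mpoly_act_def sum_distrib_left lookup_add algebra_simps)
  finally show "mpoly_act (P * Q) F m = mpoly_act P (mpoly_act Q F) m" .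
qed

lemma mpoly_act_one_series:
  "mpoly_act P one_series (\<lambda>i. int (Poly_Mapping.lookup k i)) = Poly_Mapping.lookup P k"
proof -
  have *: "(\<lambda>i. int (Poly_Mapping.lookup k i) - int (Poly_Mapping.lookup l i)) = (\<lambda>_. 0) \<longleftrightarrow> l = k"
    for l :: "int \<Rightarrow>\<^sub>0 nat"
    by (auto simp: fun_eq_iff poly_mapping_eq_iff)
  show ?thesis
    by (subst mpoly_act_superset[of "insert k (Poly_Mapping.keys P)"])
      (auto simp: one_series_def * if_distrib[of "(*) _"] cong: if_cong)
qed

lemma rational_extension_eqI:
  assumes "Q \<noteq> 0" "mpoly_act Q F = mpoly_act P one_series"
  shows "rational_extension F = Fract P Q"
  unfolding rational_extension_def
proof (rule the_equality)
  show "\<exists>P' Q'. Q' \<noteq> 0 \<and> Fract P Q = Fract P' Q' \<and> mpoly_act Q' F = mpoly_act P' one_series"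
    using assms by blast
next
  fix R assume "\<exists>P' Q'. Q' \<noteq> 0 \<and> R = Fract P' Q' \<and> mpoly_act Q' F = mpoly_act P' one_series"
  then obtain P' Q' where *: "Q' \<noteq> 0" "R = Fract P' Q'" "mpoly_act Q' F = mpoly_act P' one_series"
    by blast
  have "mpoly_act (Q * P') one_series = mpoly_act (Q' * P) one_series"
    unfolding mpoly_act_mult using assms * by (metis mpoly_act_mult mult.commute)
  then have "Q * P' = Q' * P"
    by (intro poly_mapping_eqI) (metis mpoly_act_one_series)
  then show "R = Fract P Q"
    using assms * by (simp add: eq_fract mult.commute)
qed

text \<open>For \<open>xs = [(v\<^sub>1,a\<^sub>1), \<dots>, (v\<^sub>n,a\<^sub>n)]\<close> with distinct \<open>a\<^sub>k\<close>, the series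
  \<open>\<langle>\<one>, Y(v\<^sub>1,y\<^sub>1) \<cdots> Y(v\<^sub>n,y\<^sub>n)\<one>\<rangle>\<close> and its rational extension, where \<open>y\<^sub>k\<close> is the
  variable with index \<open>a\<^sub>k\<close>.\<close>

definition matrix_element ::
    "'v voa_data \<Rightarrow> ('v \<Rightarrow> 'v \<Rightarrow> complex) \<Rightarrow> ('v \<times> int) list \<Rightarrow> formal_series" where
  "matrix_element V B xs m =
     (if \<forall>a. a \<notin> snd ` set xs \<longrightarrow> m a = 0
      then B (vac V) (foldr (\<lambda>(v, a). mode V v (- m a - 1)) xs (vac V)) else 0)"

definition Z0 :: "'v voa_data \<Rightarrow> ('v \<Rightarrow> 'v \<Rightarrow> complex) \<Rightarrow> ('v \<times> int) list \<Rightarrow> ratfun" where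
  "Z0 V B xs = rational_extension (matrix_element V B xs)"

lemma Z0_Nil: "Z0 V B [] = const (B (vac V) (vac V))"
  unfolding Z0_def const_def
  by (rule rational_extension_eqI) (auto simp: fun_eq_iff mpoly_act_single matrix_element_def one_series_def mpoly_act_def)

section \<open>The genus g partition function\<close>

text \<open>Formal power series in the \<open>\<rho>\<^sub>a\<close> with coefficients in the rational functions of the \<open>w\<^sub>a\<close>;
  the exponent of \<open>\<rho>\<^sub>a\<close> is stored at the index \<open>a \<ge> 1\<close>, and \<open>\<rho>\<^sub>-\<^sub>a = \<rho>\<^sub>a\<close>.\<close>

type_synonym rho_series = "(int \<Rightarrow>\<^sub>0 nat) \<Rightarrow> ratfun"

text \<open>The vectors \<open>dual a b\<close> form the basis dual to \<open>basis a\<close>. Since \<open>b\<^sub>-\<^sub>a = \<rho>\<^sub>a\<^bsup>wt(b\<^sub>a)\<^esup> dual a b\<^sub>a\<close>,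
  the coefficient of \<open>\<Prod>\<^sub>a \<rho>\<^sub>a\<^bsup>n(a)\<^esup>\<close> is the finite sum over those \<open>b\<^sub>a\<close> that have weight \<open>n(a)\<close>.\<close>

definition partition_function ::
    "'v voa_data \<Rightarrow> ('v \<Rightarrow> 'v \<Rightarrow> complex) \<Rightarrow> (int \<Rightarrow> 'v set) \<Rightarrow> (int \<Rightarrow> 'v \<Rightarrow> 'v) \<Rightarrow> nat \<Rightarrow> rho_series"
  where
  "partition_function V B basis dual g n =
     (if Poly_Mapping.keys n \<subseteq> {1..int g}
      then \<Sum>b \<in> (\<Pi>\<^sub>E a\<in>{1..int g}. basis a \<inter> wt_space V (int (Poly_Mapping.lookup n a))).
             Z0 V B (concat (map (\<lambda>a. [(b a, a), (dual a (b a), - a)]) [1..int g]))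
      else 0)"

definition partial_w :: "int \<Rightarrow> rho_series \<Rightarrow> rho_series" where
  "partial_w a F n = pdiff a (F n)"

definition partial_rho :: "int \<Rightarrow> rho_series \<Rightarrow> rho_series" where
  "partial_rho a F n =
     of_nat (Poly_Mapping.lookup n \<bar>a\<bar> + 1) * F (n + Poly_Mapping.single \<bar>a\<bar> 1)"

definition times_rho :: "int \<Rightarrow> rho_series \<Rightarrow> rho_series" where
  "times_rho a F n =
     (if Poly_Mapping.lookup n \<bar>a\<bar> = 0 then 0 else F (n - Poly_Mapping.single \<bar>a\<bar> 1))"

definition poly_at :: "complex poly \<Rightarrow> int \<Rightarrow> ratfun" where
  "poly_at p a = poly (map_poly const p) (var a)"

definition divided_deriv :: "nat \<Rightarrow> complex poly \<Rightarrow> complex poly" where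
  "divided_deriv i p = smult (1 / fact i) ((pderiv ^^ i) p)"

definition index_set :: "nat \<Rightarrow> int set" where
  "index_set g = {a. 1 \<le> \<bar>a\<bar> \<and> \<bar>a\<bar> \<le> int g}"

definition D_op :: "nat \<Rightarrow> complex poly \<Rightarrow> rho_series \<Rightarrow> rho_series" where
  "D_op g p F n = (\<Sum>a\<in>index_set g.
       poly_at p a * partial_w a F n +
       poly_at (divided_deriv 1 p) a * times_rho a (partial_rho a F) n +
       poly_at (divided_deriv 2 p) a * times_rho a (partial_w (- a) F) n)"

end

theory Submission
  imports Defs
begin

text \<open>
  The adjoint of \<open>L(n)\<close> is \<open>L(-n)\<close>, and \<open>L(-1), L(0), L(1)\<close> annihilate the vacuum, so for \<open>j = 0, 1, 2\<close>
  \<open>\<langle>\<one>, L(j-1) Y(v\<^sub>1,y\<^sub>1) \<cdots> Y(v\<^sub>n,y\<^sub>n) \<one>\<rangle> = 0\<close>. Moving \<open>L(j-1)\<close>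
  through the product with the commutator formula
  \<open>[L(j-1), Y(v,y)] = \<Sum>\<^sub>i\<^sub>\<le>\<^sub>j (j choose i) y\<^bsup>j-i\<^esup> Y(L(i-1)v, y)\<close>
  gives the genus zero Ward identity: for \<open>p\<close> of degree at most two and homogeneous \<open>v\<^sub>k\<close>,
  the sum over \<open>k\<close> of
  \<open>p(y\<^sub>k) \<partial>\<^sub>k Z\<^sup>(\<^sup>0\<^sup>) + p'(y\<^sub>k) wt(v\<^sub>k) Z\<^sup>(\<^sup>0\<^sup>) + (p''/2)(y\<^sub>k) Z\<^sup>(\<^sup>0\<^sup>)(\<dots>; L(1)v\<^sub>k, y\<^sub>k; \<dots>)\<close>
  vanishes (\<open>ward_identity\<close>). It is summed over the bases. Since \<open>b\<^sub>a\<close> and its dual vector both have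
  the weight that is the exponent of \<open>\<rho>\<^sub>a\<close>, the first two summands become
  \<open>p(w\<^sub>a) \<partial>\<^bsub>w_a\<^esub>\<close> and \<open>p'(w\<^sub>a) \<rho>\<^sub>a \<partial>\<^bsub>\<rho>_a\<^esub>\<close>. In the third one
  \<open>\<Sum>\<^sub>b (L(1) b) \<otimes> b\<^sup>* = \<Sum>\<^sub>c c \<otimes> (L(-1) c\<^sup>*)\<close>, where \<open>b\<close> runs over a basis of weight \<open>k\<close> and
  \<open>c\<close> over one of weight \<open>k - 1\<close>: the insertion of \<open>L(1)\<close> at \<open>w\<^sub>a\<close> is a derivative with respect to
  \<open>w\<^sub>-\<^sub>a\<close> together with a shift of the exponent of \<open>\<rho>\<^sub>a\<close>, which is the third summand of the operator
  (\<open>sum_L1_insertions\<close>).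

  These computations are made with coefficients of formal series. To transfer them to rational
  functions, the matrix elements must be shown to extend to rational functions at all
  (\<open>correlation_rational\<close>). By locality, multiplication with a power of \<open>y\<^sub>i - y\<^sub>j\<close> makes the vertex
  operators at \<open>y\<^sub>i\<close> and \<open>y\<^sub>j\<close> commute; once the operator at \<open>y\<^sub>i\<close> acts first on the vacuum, only
  non-negative powers of \<open>y\<^sub>i\<close> occur. A suitable product of differences therefore removes all negative
  exponents. As the \<open>L(0)\<close>-grading fixes the total degree, what remains is a polynomial.
\<close>

section \<open>Formal series that expand rational functions\<close>

text \<open>The relation underlying \<open>rational_extension\<close>. In contrast to the description operator it carries
  the existence of the rational function, and it is compatible with all linear operations.\<close>

definition has_extension :: "formal_series \<Rightarrow> ratfun \<Rightarrow> bool" where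
  "has_extension F R \<longleftrightarrow> (\<exists>P Q. Q \<noteq> 0 \<and> R = Fract P Q \<and> mpoly_act Q F = mpoly_act P one_series)"

definition formal_deriv :: "int \<Rightarrow> formal_series \<Rightarrow> formal_series" where
  "formal_deriv a F m = of_int (m a + 1) * F (m(a := m a + 1))"

lemma rational_extension_eq: "has_extension F R \<Longrightarrow> rational_extension F = R"
  unfolding has_extension_def using rational_extension_eqI by blast

lemma mpoly_act_add_right:
  "mpoly_act P (\<lambda>m. F m + G m) = (\<lambda>m. mpoly_act P F m + mpoly_act P G m)"
  by (simp add: mpoly_act_def algebra_simps sum.distrib fun_eq_iff)

lemma mpoly_act_zero_right: "mpoly_act P (\<lambda>m. 0) = (\<lambda>m. 0)"
  by (simp add: mpoly_act_def fun_eq_iff)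

lemma mpoly_act_commute: "mpoly_act P (mpoly_act Q F) = mpoly_act Q (mpoly_act P F)"
  by (simp only: mpoly_act_mult[symmetric] mult.commute)

lemma has_extensionI:
  "Q \<noteq> 0 \<Longrightarrow> R = Fract P Q \<Longrightarrow> mpoly_act Q F = mpoly_act P one_series \<Longrightarrow> has_extension F R"
  unfolding has_extension_def by blast

lemma has_extension_zero: "has_extension (\<lambda>_. 0) 0"
  unfolding has_extension_def
  by (rule exI[of _ 0], rule exI[of _ 1]) (simp add: mpoly_act_def fun_eq_iff Zero_fract_def)

lemma has_extension_unique: "has_extension F R \<Longrightarrow> has_extension F S \<Longrightarrow> R = S"
  by (auto dest!: rational_extension_eq)

lemma has_extension_add:
  assumes "has_extension F R" "has_extension G S"
  shows "has_extension (\<lambda>m. F m + G m) (R + S)"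
proof -
  from assms obtain P Q P' Q' where
    F: "Q \<noteq> 0" "R = Fract P Q" "mpoly_act Q F = mpoly_act P one_series" and
    G: "Q' \<noteq> 0" "S = Fract P' Q'" "mpoly_act Q' G = mpoly_act P' one_series"
    unfolding has_extension_def by blast
  have "mpoly_act (Q * Q') F = mpoly_act (P * Q') one_series"
    by (simp only: mult.commute[of _ Q'] mpoly_act_mult F(3))
  moreover have "mpoly_act (Q * Q') G = mpoly_act (P' * Q) one_series"
    by (simp only: mult.commute[of _ Q] mpoly_act_mult G(3))
  ultimately have "mpoly_act (Q * Q') (\<lambda>m. F m + G m) = mpoly_act (P * Q' + P' * Q) one_series"
    by (simp add: mpoly_act_add_right mpoly_act_add fun_eq_iff)
  moreover have "R + S = Fract (P * Q' + P' * Q) (Q * Q')"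
    using F G by simp
  moreover have "Q * Q' \<noteq> 0"
    using F(1) G(1) by simp
  ultimately show ?thesis
    by (intro has_extensionI)
qed

lemma has_extension_mpoly_act:
  assumes "has_extension F R"
  shows "has_extension (mpoly_act P F) (Fract P 1 * R)"
proof -
  from assms obtain P' Q where
    F: "Q \<noteq> 0" "R = Fract P' Q" "mpoly_act Q F = mpoly_act P' one_series"
    unfolding has_extension_def by blast
  have "mpoly_act Q (mpoly_act P F) = mpoly_act (P * P') one_series"
    by (subst mpoly_act_commute) (simp only: mpoly_act_mult F(3))
  moreover have "Fract P 1 * R = Fract (P * P') Q"
    using F by simp
  ultimately show ?thesis
    using F(1) by (intro has_extensionI)
qed

lemma has_extension_scale:
  assumes "has_extension F R"
  shows "has_extension (\<lambda>m. c * F m) (const c * R)"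
proof -
  have "mpoly_act (Poly_Mapping.single 0 c) F = (\<lambda>m. c * F m)"
    by (simp add: mpoly_act_single fun_eq_iff)
  then show ?thesis
    using has_extension_mpoly_act[OF assms, of "Poly_Mapping.single 0 c"] by (simp add: const_def)
qed

lemma has_extension_sum:
  assumes "\<And>x. x \<in> A \<Longrightarrow> has_extension (F x) (R x)"
  shows "has_extension (\<lambda>m. \<Sum>x\<in>A. F x m) (\<Sum>x\<in>A. R x)"
  using assms
  by (induction A rule: infinite_finite_induct) (auto intro: has_extension_zero has_extension_add)

definition mvar :: "int \<Rightarrow> mpoly" where
  "mvar a = Poly_Mapping.single (Poly_Mapping.single a 1) 1"

lemma mvar_power: "mvar a ^ k = Poly_Mapping.single (Poly_Mapping.single a k) 1"
proof (induction k)
  case (Suc k)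
  then show ?case
    by (simp add: mvar_def mult_single flip: single_add)
qed simp

lemma var_power: "var a ^ k = Fract (mvar a ^ k) 1"
  by (induction k) (simp_all add: One_fract_def var_def mvar_def)

lemma has_extension_var_power:
  assumes "has_extension F R"
  shows "has_extension (\<lambda>m. F (m(a := m a - int k))) (var a ^ k * R)"
proof -
  have "mpoly_act (mvar a ^ k) F = (\<lambda>m. F (m(a := m a - int k)))"
    unfolding mvar_power
    by (rule ext)
      (auto simp: mpoly_act_single lookup_single fun_eq_iff when_def intro!: arg_cong[of _ _ F])
  then show ?thesis
    using has_extension_mpoly_act[OF assms, of "mvar a ^ k"] by (simp add: var_power)
qed

lemma formal_deriv_mpoly_act_single:
  "formal_deriv a (mpoly_act (Poly_Mapping.single k c) F) m =
   mpoly_act (mpoly_pderiv a (Poly_Mapping.single k c)) F m +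
   mpoly_act (Poly_Mapping.single k c) (formal_deriv a F) m"
proof -
  define m' where "m' = (\<lambda>i. m i - int (Poly_Mapping.lookup k i))"
  define X where "X = F (m'(a := m' a + 1))"
  have 1: "(\<lambda>i. (m(a := m a + 1)) i - int (Poly_Mapping.lookup k i)) = m'(a := m' a + 1)"
    by (auto simp: m'_def fun_eq_iff)
  have 2: "of_nat (Poly_Mapping.lookup k a) *
      F (\<lambda>i. m i - int (Poly_Mapping.lookup (k - Poly_Mapping.single a 1) i)) =
      of_nat (Poly_Mapping.lookup k a) * X"
  proof (cases "Poly_Mapping.lookup k a = 0")
    case False
    then have "(\<lambda>i. m i - int (Poly_Mapping.lookup (k - Poly_Mapping.single a 1) i)) = m'(a := m' a + 1)"
      by (auto simp: m'_def fun_eq_iff lookup_minus lookup_single when_def)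
    then show ?thesis by (simp add: X_def)
  qed simp
  have "mpoly_act (mpoly_pderiv a (Poly_Mapping.single k c)) F m =
      c * (of_nat (Poly_Mapping.lookup k a) *
      F (\<lambda>i. m i - int (Poly_Mapping.lookup (k - Poly_Mapping.single a 1) i)))"
    by (simp add: mpoly_pderiv_single mpoly_act_single)
  then have "mpoly_act (mpoly_pderiv a (Poly_Mapping.single k c)) F m =
      c * of_nat (Poly_Mapping.lookup k a) * X"
    by (simp only: 2 mult.assoc)
  moreover have "formal_deriv a (mpoly_act (Poly_Mapping.single k c) F) m = of_int (m a + 1) * (c * X)"
    unfolding formal_deriv_def mpoly_act_single 1 X_def ..
  moreover have "mpoly_act (Poly_Mapping.single k c) (formal_deriv a F) m = c * (of_int (m' a + 1) * X)"
    unfolding mpoly_act_single formal_deriv_def m'_def[symmetric] X_def ..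
  ultimately show ?thesis
    by (simp add: m'_def algebra_simps)
qed

lemma formal_deriv_mpoly_act:
  "formal_deriv a (mpoly_act Q F) m =
   mpoly_act (mpoly_pderiv a Q) F m + mpoly_act Q (formal_deriv a F) m"
proof -
  let ?s = "\<lambda>k. Poly_Mapping.single k (Poly_Mapping.lookup Q k) :: mpoly"
  have "formal_deriv a (mpoly_act (\<Sum>k\<in>Poly_Mapping.keys Q. ?s k) F) m =
      (\<Sum>k\<in>Poly_Mapping.keys Q. formal_deriv a (mpoly_act (?s k) F) m)"
    by (simp add: formal_deriv_def mpoly_act_sum sum_distrib_left)
  also have "\<dots> = mpoly_act (mpoly_pderiv a (\<Sum>k\<in>Poly_Mapping.keys Q. ?s k)) F m +
      mpoly_act (\<Sum>k\<in>Poly_Mapping.keys Q. ?s k) (formal_deriv a F) m"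
    by (simp add: formal_deriv_mpoly_act_single mpoly_pderiv_sum mpoly_act_sum sum.distrib)
  finally show ?thesis
    by (simp only: mpoly_expand[symmetric])
qed

lemma formal_deriv_one_series: "formal_deriv a one_series = (\<lambda>_. 0)"
proof
  fix m :: "int \<Rightarrow> int"
  have "m a + 1 = 0" if "m(a := m a + 1) = (\<lambda>_. 0)"
    using fun_cong[OF that, of a] by simp
  then have "of_int (m a + 1) = (0 :: complex)" if "m(a := m a + 1) = (\<lambda>_. 0)"
    using that by (metis of_int_0)
  then show "formal_deriv a one_series m = 0"
    unfolding formal_deriv_def one_series_def by auto
qed

text \<open>If \<open>Q F = P\<close>, the Leibniz rule gives \<open>Q (\<partial>F) = \<partial>P - (\<partial>Q) F\<close>; multiplying once more by \<open>Q\<close>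
  removes \<open>F\<close> from the right-hand side and leaves the quotient rule.\<close>

lemma has_extension_pdiff:
  assumes "has_extension F R"
  shows "has_extension (formal_deriv a F) (pdiff a R)"
proof -
  from assms obtain P Q where
    F: "Q \<noteq> 0" "R = Fract P Q" "mpoly_act Q F = mpoly_act P one_series"
    unfolding has_extension_def by blast
  let ?d = "mpoly_pderiv a"
  have Q: "mpoly_act Q (formal_deriv a F) m = mpoly_act (?d P) one_series m - mpoly_act (?d Q) F m" for m
    using formal_deriv_mpoly_act[of a Q F m] formal_deriv_mpoly_act[of a P one_series m] F(3)
    by (simp add: formal_deriv_one_series mpoly_act_zero_right)
  have "mpoly_act (Q * Q) (formal_deriv a F) m =
      mpoly_act Q (mpoly_act (?d P) one_series) m - mpoly_act Q (mpoly_act (?d Q) F) m" for m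
    using mpoly_act_add_right[of Q "mpoly_act Q (formal_deriv a F)" "mpoly_act (?d Q) F"]
    by (simp add: Q mpoly_act_mult fun_eq_iff)
  moreover have "mpoly_act Q (mpoly_act (?d Q) F) = mpoly_act (P * ?d Q) one_series"
    by (subst mpoly_act_commute) (simp only: F(3) mpoly_act_mult mult.commute[of P])
  moreover have "mpoly_act Q (mpoly_act (?d P) one_series) = mpoly_act (?d P * Q) one_series"
    by (simp only: mpoly_act_mult mult.commute[of _ Q])
  moreover have "mpoly_act (?d P * Q - P * ?d Q) one_series m =
      mpoly_act (?d P * Q) one_series m - mpoly_act (P * ?d Q) one_series m" for m
    using mpoly_act_add[of "?d P * Q - P * ?d Q" "P * ?d Q" one_series m] by simp
  ultimately have "mpoly_act (Q * Q) (formal_deriv a F) = mpoly_act (?d P * Q - P * ?d Q) one_series"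
    by (intro ext) simp
  moreover have "pdiff a R = Fract (?d P * Q - P * ?d Q) (Q * Q)"
    using F by (simp add: pdiff_Fract)
  moreover have "Q * Q \<noteq> 0"
    using F(1) by simp
  ultimately show ?thesis
    by (intro has_extensionI)
qed

lemma pdiff_add: "pdiff a (R + S) = pdiff a R + pdiff a S"
proof -
  obtain P Q where R: "R = Fract P Q" "Q \<noteq> 0" by (cases R) auto
  obtain P' Q' where S: "S = Fract P' Q'" "Q' \<noteq> 0" by (cases S) auto
  show ?thesis
    using R S by (simp add: pdiff_Fract mpoly_pderiv_add mpoly_pderiv_mult eq_fract algebra_simps)
qed

lemma pdiff_sum: "pdiff a (sum f A) = (\<Sum>x\<in>A. pdiff a (f x))"
proof -
  have "pdiff a 0 = 0"
    by (simp add: Zero_fract_def pdiff_Fract mpoly_pderiv_zero eq_fract)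
  then show ?thesis
    by (induction A rule: infinite_finite_induct) (simp_all add: pdiff_add)
qed

lemma const_zero: "const 0 = 0"
  by (simp add: const_def Zero_fract_def)

lemma const_of_nat: "const (of_nat n) = of_nat n"
  by (simp add: const_def single_of_nat Fract_of_nat_eq)

section \<open>Clearing denominators\<close>

definition homogeneous_series :: "int set \<Rightarrow> int \<Rightarrow> formal_series \<Rightarrow> bool" where
  "homogeneous_series A d F \<longleftrightarrow> (\<forall>m. F m \<noteq> 0 \<longrightarrow> (\<forall>a. a \<notin> A \<longrightarrow> m a = 0) \<and> sum m A = d)"

text \<open>The property of non-zero homogeneous polynomials in the variables in \<open>A\<close> that is used for common
  denominators. Stating it through the action makes closure under products immediate.\<close>

definition degree_shifting :: "int set \<Rightarrow> mpoly \<Rightarrow> bool" where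
  "degree_shifting A Q \<longleftrightarrow> Q \<noteq> 0 \<and>
     (\<exists>e. \<forall>d F. homogeneous_series A d F \<longrightarrow> homogeneous_series A (d + e) (mpoly_act Q F))"

lemma mpoly_act_one: "mpoly_act 1 F = F"
  using mpoly_act_single[of 0 1 F] by (simp add: fun_eq_iff)

lemma degree_shifting_one: "degree_shifting A 1"
  unfolding degree_shifting_def by (auto simp: mpoly_act_one intro!: exI[of _ 0])

lemma degree_shifting_mult:
  assumes "degree_shifting A P" "degree_shifting A Q"
  shows "degree_shifting A (P * Q)"
proof -
  from assms obtain e e' where
    "\<And>d F. homogeneous_series A d F \<Longrightarrow> homogeneous_series A (d + e) (mpoly_act P F)"
    "\<And>d F. homogeneous_series A d F \<Longrightarrow> homogeneous_series A (d + e') (mpoly_act Q F)"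
    unfolding degree_shifting_def by blast
  then have "homogeneous_series A (d + (e' + e)) (mpoly_act (P * Q) F)"
    if "homogeneous_series A d F" for d F
    using that by (simp add: mpoly_act_mult flip: add.assoc)
  with assms show ?thesis
    unfolding degree_shifting_def by (metis mult_eq_0_iff)
qed

lemma degree_shifting_power: "degree_shifting A P \<Longrightarrow> degree_shifting A (P ^ n)"
  by (induction n) (simp_all add: degree_shifting_one degree_shifting_mult)

lemma mpoly_act_mvar: "mpoly_act (mvar a) F m = F (m(a := m a - 1))"
  by (auto simp: mvar_def mpoly_act_single lookup_single fun_eq_iff when_def intro!: arg_cong[of _ _ F])

lemma mpoly_act_diff: "mpoly_act (P - Q) F m = mpoly_act P F m - mpoly_act Q F m"
  using mpoly_act_add[of "P - Q" Q F m] by simp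

lemma degree_shifting_diff:
  assumes "finite A" "a \<in> A" "b \<in> A" "a \<noteq> b"
  shows "degree_shifting A (mvar a - mvar b)"
proof -
  have "mvar a \<noteq> mvar b"
    using assms(4) unfolding mvar_def by (metis lookup_single_eq lookup_single_not_eq one_neq_zero)
  moreover have "homogeneous_series A (d + 1) (mpoly_act (mvar a - mvar b) F)"
    if F: "homogeneous_series A d F" for d F
    unfolding homogeneous_series_def
  proof (intro allI impI)
    fix m assume "mpoly_act (mvar a - mvar b) F m \<noteq> 0"
    then have "F (m(a := m a - 1)) \<noteq> 0 \<or> F (m(b := m b - 1)) \<noteq> 0"
      unfolding mpoly_act_diff mpoly_act_mvar by auto
    then obtain c where c: "c \<in> A" "F (m(c := m c - 1)) \<noteq> 0"
      using assms by blast
    then have "\<forall>x. x \<notin> A \<longrightarrow> (m(c := m c - 1)) x = 0" "sum (m(c := m c - 1)) A = d"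
      using F unfolding homogeneous_series_def by blast+
    moreover have "sum (m(c := m c - 1)) A = sum m A - 1"
      using c(1) assms(1) by (simp add: sum.remove[of A c])
    ultimately show "(\<forall>x. x \<notin> A \<longrightarrow> m x = 0) \<and> sum m A = d + 1"
      using c(1) by (metis add.commute diff_add_cancel fun_upd_other add_diff_cancel)
  qed
  ultimately show ?thesis
    unfolding degree_shifting_def by (auto intro!: exI[of _ 1])
qed

lemma mpoly_act_nonneg:
  assumes "\<And>m. F m \<noteq> 0 \<Longrightarrow> m a \<ge> 0" "mpoly_act Q F m \<noteq> 0"
  shows "m a \<ge> 0"
proof -
  from assms(2) obtain k where "F (\<lambda>i. m i - int (Poly_Mapping.lookup k i)) \<noteq> 0"
    unfolding mpoly_act_def by (metis (no_types, lifting) mult_zero_right sum.neutral)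
  then show ?thesis
    using assms(1)[of "\<lambda>i. m i - int (Poly_Mapping.lookup k i)"] by simp
qed

lemma polynomial_if_finite_support:
  assumes "finite {m. F m \<noteq> 0}" "finite A"
    and "\<And>m a. F m \<noteq> 0 \<Longrightarrow> m a \<ge> 0" "\<And>m a. F m \<noteq> 0 \<Longrightarrow> a \<notin> A \<Longrightarrow> m a = 0"
  shows "\<exists>P. F = mpoly_act P one_series"
proof -
  define e where "e m = Abs_poly_mapping (\<lambda>i. nat (m i))" for m :: "int \<Rightarrow> int"
  have e: "(\<lambda>i. int (Poly_Mapping.lookup (e m) i)) = m" if "F m \<noteq> 0" for m
  proof -
    have "{i. nat (m i) \<noteq> 0} \<subseteq> A"
      using assms(4)[OF that] by force
    then have "finite {i. nat (m i) \<noteq> 0}"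
      using assms(2) finite_subset by blast
    then show ?thesis
      using assms(3)[OF that] by (auto simp: e_def fun_eq_iff)
  qed
  define P where "P = (\<Sum>m | F m \<noteq> 0. Poly_Mapping.single (e m) (F m))"
  have "mpoly_act P one_series m = F m" for m
  proof -
    have "mpoly_act P one_series m =
        (\<Sum>m' | F m' \<noteq> 0. F m' * one_series (\<lambda>i. m i - int (Poly_Mapping.lookup (e m') i)))"
      by (simp add: P_def mpoly_act_sum mpoly_act_single)
    also have "\<dots> = (\<Sum>m' | F m' \<noteq> 0. if m' = m then F m' else 0)"
    proof (rule sum.cong[OF refl])
      fix m' assume "m' \<in> {m'. F m' \<noteq> 0}"
      then have "(\<lambda>i. int (Poly_Mapping.lookup (e m') i)) = m'"
        by (intro e) simp
      then have "(\<lambda>i. m i - int (Poly_Mapping.lookup (e m') i)) = (\<lambda>i. m i - m' i)"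
        by (metis (no_types))
      then show "F m' * one_series (\<lambda>i. m i - int (Poly_Mapping.lookup (e m') i)) =
          (if m' = m then F m' else 0)"
        unfolding one_series_def by (simp add: fun_eq_iff eq_commute[of "m _"])
    qed
    also have "\<dots> = F m"
      using assms(1) by (simp add: sum.delta')
    finally show ?thesis .
  qed
  then show ?thesis by (metis ext)
qed

text \<open>A fixed total degree and non-negative exponents leave only finitely many monomials.\<close>

lemma homogeneous_nonneg_polynomial:
  assumes "finite A" "homogeneous_series A d F" "\<And>m a. a \<in> A \<Longrightarrow> F m \<noteq> 0 \<Longrightarrow> m a \<ge> 0"
  shows "\<exists>P. F = mpoly_act P one_series"
proof -
  have out: "m a = 0" if "F m \<noteq> 0" "a \<notin> A" for m a
    using assms(2) that unfolding homogeneous_series_def by blast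
  have nonneg: "m a \<ge> 0" if "F m \<noteq> 0" for m a
    using assms(3) out that by (metis order_refl)
  have bound: "m a \<le> d" if "F m \<noteq> 0" "a \<in> A" for m a
  proof -
    have "m a \<le> sum m A"
      using that nonneg assms(1) by (intro member_le_sum) auto
    then show ?thesis
      using assms(2) that(1) unfolding homogeneous_series_def by auto
  qed
  have "{m. F m \<noteq> 0} \<subseteq> {m. \<forall>a. (a \<in> A \<longrightarrow> m a \<in> {0..d}) \<and> (a \<notin> A \<longrightarrow> m a = 0)}"
    using out nonneg bound by auto
  moreover have "finite {m. \<forall>a. (a \<in> A \<longrightarrow> m a \<in> {0..d}) \<and> (a \<notin> A \<longrightarrow> m a = (0::int))}"
    using assms(1) by (intro finite_set_of_finite_funs) auto
  ultimately have "finite {m. F m \<noteq> 0}"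
    using finite_subset by blast
  then show ?thesis
    using polynomial_if_finite_support[of F A] assms(1) nonneg out by blast
qed

lemma minus_mvar_power:
  "(- mvar a) ^ k = Poly_Mapping.single (Poly_Mapping.single a k) ((-1) ^ k)"
proof (induction k)
  case (Suc k)
  then show ?case
    by (simp add: mvar_def mult_single single_uminus flip: single_add)
qed simp

lemma mpoly_act_diff_power:
  assumes "a \<noteq> b"
  shows "mpoly_act ((mvar a - mvar b) ^ N) F m =
    (\<Sum>i\<le>N. (-1) ^ i * of_nat (N choose i) * F (m(a := m a - int (N - i), b := m b - int i)))"
proof -
  have "(mvar a - mvar b) ^ N = (- mvar b + mvar a) ^ N"
    by simp
  also have "\<dots> = (\<Sum>i\<le>N. of_nat (N choose i) * (- mvar b) ^ i * mvar a ^ (N - i))"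
    by (rule binomial_ring)
  also have "\<dots> = (\<Sum>i\<le>N. Poly_Mapping.single (Poly_Mapping.single b i + Poly_Mapping.single a (N - i))
      ((-1) ^ i * of_nat (N choose i)))"
    by (simp only: minus_mvar_power mvar_power single_of_nat[symmetric] mult_single) (simp add: mult.commute)
  finally have 1: "(mvar a - mvar b) ^ N = (\<Sum>i\<le>N. Poly_Mapping.single
      (Poly_Mapping.single b i + Poly_Mapping.single a (N - i)) ((-1) ^ i * of_nat (N choose i)))" .
  have 2: "(\<lambda>x. m x - int (Poly_Mapping.lookup (Poly_Mapping.single b i + Poly_Mapping.single a (N - i)) x)) =
      m(a := m a - int (N - i), b := m b - int i)" for i
    using assms by (auto simp: fun_eq_iff lookup_add lookup_single when_def)
  show ?thesis
    unfolding 1 mpoly_act_sum mpoly_act_single 2 ..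
qed

section \<open>Modes and correlation functions\<close>

text \<open>The vanishing of the negative weight spaces makes \<open>L(1)\<close> vanish on vectors of weight \<open>0\<close>.\<close>

locale voa_with_form = vertex_operator_algebra V
  for V :: "('v :: ab_group_add) voa_data" +
  fixes B :: "'v \<Rightarrow> 'v \<Rightarrow> complex"
  assumes form_bilinear: "bilinear_form B"
    and form_nondegenerate: "nondegenerate B"
    and form_invariant: "invariant B"
    and no_negative_weights: "n < 0 \<Longrightarrow> wt_space V n = {0}"
begin

abbreviation scl (infixr "\<bullet>" 75) where "c \<bullet> v \<equiv> vscale V c v"
abbreviation \<omega> where "\<omega> \<equiv> conformal V"
abbreviation vacuum_vector where "vacuum_vector \<equiv> vac V"

lemma mode_right:
  shows mode_add_right: "mode V u n (v + w) = mode V u n v + mode V u n w"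
    and mode_scale_right: "mode V u n (c \<bullet> v) = c \<bullet> mode V u n v"
    and mode_zero_right: "mode V u n 0 = 0"
    and mode_sum_right: "mode V u n (sum f S) = (\<Sum>s\<in>S. mode V u n (f s))"
proof -
  interpret l: Vector_Spaces.linear "vscale V" "vscale V" "\<lambda>v. mode V u n v"
    by (rule mode_linear_right)
  show "mode V u n (v + w) = mode V u n v + mode V u n w" by (rule l.add)
  show "mode V u n (c \<bullet> v) = c \<bullet> mode V u n v" by (rule l.scale)
  show "mode V u n 0 = 0" by (rule l.zero)
  show "mode V u n (sum f S) = (\<Sum>s\<in>S. mode V u n (f s))" by (rule l.sum)
qed

lemma mode_left:
  shows mode_scale_left: "mode V (c \<bullet> u) n v = c \<bullet> mode V u n v"
    and mode_zero_left: "mode V 0 n v = 0"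
    and mode_sum_left: "mode V (sum f S) n v = (\<Sum>s\<in>S. mode V (f s) n v)"
proof -
  interpret l: Vector_Spaces.linear "vscale V" "vscale V" "\<lambda>u. mode V u n v"
    by (rule mode_linear_left)
  show "mode V (c \<bullet> u) n v = c \<bullet> mode V u n v" by (rule l.scale)
  show "mode V 0 n v = 0" by (rule l.zero)
  show "mode V (sum f S) n v = (\<Sum>s\<in>S. mode V (f s) n v)" by (rule l.sum)
qed

lemma form_left:
  shows form_add_left: "B (x + x') y = B x y + B x' y"
    and form_scale_left: "B (c \<bullet> x) y = c * B x y"
    and form_zero_left: "B 0 y = 0"
    and form_sum_left: "B (sum f S) y = (\<Sum>s\<in>S. B (f s) y)"
proof -
  interpret l: Vector_Spaces.linear "vscale V" "(*)" "\<lambda>x. B x y"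
    using form_bilinear unfolding bilinear_form_def by blast
  show "B (x + x') y = B x y + B x' y" by (rule l.add)
  show "B (c \<bullet> x) y = c * B x y" by (rule l.scale)
  show "B 0 y = 0" by (rule l.zero)
  show "B (sum f S) y = (\<Sum>s\<in>S. B (f s) y)" by (rule l.sum)
qed

lemma form_right:
  shows form_diff_right: "B x (y - y') = B x y - B x y'"
    and form_scale_right: "B x (c \<bullet> y) = c * B x y"
    and form_zero_right: "B x 0 = 0"
    and form_sum_right: "B x (sum f S) = (\<Sum>s\<in>S. B x (f s))"
proof -
  interpret l: Vector_Spaces.linear "vscale V" "(*)" "\<lambda>y. B x y"
    using form_bilinear unfolding bilinear_form_def by blast
  show "B x (y - y') = B x y - B x y'" by (rule l.diff)
  show "B x (c \<bullet> y) = c * B x y" by (rule l.scale)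
  show "B x 0 = 0" by (rule l.zero)
  show "B x (sum f S) = (\<Sum>s\<in>S. B x (f s))" by (rule l.sum)
qed

text \<open>The Borcherds identity with \<open>q = 0\<close>, where both sums on the right collapse to their
  first term.\<close>

lemma commutator_formula:
  "mode V u (int j) (mode V v n w) = mode V v n (mode V u (int j) w) +
    (\<Sum>i\<le>j. of_nat (j choose i) \<bullet> mode V (mode V u (int i) v) (int j + n - int i) w)"
proof -
  have l: "Sum_any (\<lambda>i::nat. (of_int (int j) gchoose i) \<bullet>
      mode V (mode V u (0 + int i) v) (int j + n - int i) w) =
    (\<Sum>i\<le>j. of_nat (j choose i) \<bullet> mode V (mode V u (int i) v) (int j + n - int i) w)"
    by (subst Sum_any.expand_superset[of "{..j}"])
      (auto simp: binomial_gbinomial[symmetric] not_less[symmetric])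
  have r1: "Sum_any (\<lambda>i::nat. ((-1) ^ i * (of_int 0 gchoose i)) \<bullet>
      mode V u (int j + 0 - int i) (mode V v (n + int i) w)) = mode V u (int j) (mode V v n w)"
    by (subst Sum_any.expand_superset[of "{0}"]) (auto simp: gbinomial_0_left split: if_splits)
  have r2: "Sum_any (\<lambda>i::nat. ((-1) ^ i * (-1) powi 0 * (of_int 0 gchoose i)) \<bullet>
      mode V v (n + 0 - int i) (mode V u (int j + int i) w)) = mode V v n (mode V u (int j) w)"
    by (subst Sum_any.expand_superset[of "{0}"]) (auto simp: gbinomial_0_left split: if_splits)
  show ?thesis
    using borcherds[of "int j" u 0 v n w] unfolding l r1 r2 by (simp add: algebra_simps)
qed

text \<open>The Borcherds identity with \<open>q = N\<close> so large that \<open>u\<^sub>N\<^sub>+\<^sub>i v = 0\<close> for all \<open>i\<close>, so that its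
  left-hand side disappears. The two sums are the coefficients of \<open>(y - z)\<^sup>N Y(u,y) Y(v,z)\<close> and
  \<open>(y - z)\<^sup>N Y(v,z) Y(u,y)\<close>.\<close>

lemma locality:
  "\<exists>N. \<forall>m n w.
    (\<Sum>i\<le>N. ((-1) ^ i * of_nat (N choose i)) \<bullet> mode V u (m + int N - int i) (mode V v (n + int i) w)) =
    (\<Sum>i\<le>N. ((-1) ^ i * (-1) ^ N * of_nat (N choose i)) \<bullet>
      mode V v (n + int N - int i) (mode V u (m + int i) w))"
proof -
  obtain N0 where N0: "\<And>k. k \<ge> N0 \<Longrightarrow> mode V u k v = 0"
    using truncation by blast
  define N where "N = nat N0"
  have "mode V u (int N + int i) v = 0" for i
    by (rule N0) (simp add: N_def)
  then have l: "Sum_any (\<lambda>i::nat. (of_int m gchoose i) \<bullet>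
      mode V (mode V u (int N + int i) v) (m + n - int i) w) = 0" for m n w
    by (simp add: mode_zero_left)
  have r1: "Sum_any (\<lambda>i::nat. ((-1) ^ i * (of_int (int N) gchoose i)) \<bullet>
      mode V u (m + int N - int i) (mode V v (n + int i) w)) =
    (\<Sum>i\<le>N. ((-1) ^ i * of_nat (N choose i)) \<bullet> mode V u (m + int N - int i) (mode V v (n + int i) w))"
    for m n w
    by (subst Sum_any.expand_superset[of "{..N}"])
      (auto simp: binomial_gbinomial[symmetric] not_less[symmetric])
  have r2: "Sum_any (\<lambda>i::nat. ((-1) ^ i * (-1) powi int N * (of_int (int N) gchoose i)) \<bullet>
      mode V v (n + int N - int i) (mode V u (m + int i) w)) =
    (\<Sum>i\<le>N. ((-1) ^ i * (-1) ^ N * of_nat (N choose i)) \<bullet>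
      mode V v (n + int N - int i) (mode V u (m + int i) w))" for m n w
    by (subst Sum_any.expand_superset[of "{..N}"])
      (auto simp: binomial_gbinomial[symmetric] not_less[symmetric])
  have "(\<Sum>i\<le>N. ((-1) ^ i * of_nat (N choose i)) \<bullet> mode V u (m + int N - int i) (mode V v (n + int i) w)) =
    (\<Sum>i\<le>N. ((-1) ^ i * (-1) ^ N * of_nat (N choose i)) \<bullet>
      mode V v (n + int N - int i) (mode V u (m + int i) w))" for m n w
    using borcherds[of m u "int N" v n w] unfolding l r1 r2 by simp
  then show ?thesis by blast
qed

lemma virasoro_vacuum: "n \<ge> -1 \<Longrightarrow> L V n vacuum_vector = 0"
  unfolding L_def by (rule creation) simp

lemma L_minus_2_vacuum: "L V (-2) vacuum_vector = \<omega>"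
  by (simp add: L_def creation)

text \<open>Since \<open>\<omega> = L(-2)\<one>\<close> and \<open>L(n)\<one> = 0\<close>, the Virasoro bracket of \<open>L(n)\<close> and \<open>L(-2)\<close> computes \<open>L(n)\<omega>\<close>.
  For \<open>n = 2\<close> the central charge would enter.\<close>

lemma L_conformal:
  assumes "n \<ge> -1" "n \<noteq> 2"
  shows "L V n \<omega> = of_int (n + 2) \<bullet> L V (n - 2) vacuum_vector"
proof -
  obtain c where "\<And>m n v. L V m (L V n v) - L V n (L V m v) = of_int (m - n) \<bullet> L V (m + n) v +
      (if m + n = 0 then (of_int (m ^ 3 - m) / 12 * c) \<bullet> v else 0)"
    using virasoro by blast
  from this[of n "-2" vacuum_vector] show ?thesis
    using assms by (simp add: virasoro_vacuum L_minus_2_vacuum) (simp add: L_def mode_zero_right)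
qed

lemma conformal_weight: "\<omega> \<in> wt_space V 2"
  using L_conformal[of 0] by (simp add: wt_space_def L_minus_2_vacuum)

lemma L_1_conformal: "L V 1 \<omega> = 0"
  using L_conformal[of 1] by (simp add: virasoro_vacuum)

text \<open>\<open>L(n)\<close> and \<open>L(-n)\<close> are adjoint: \<open>\<omega>\<close> has weight \<open>2\<close> and \<open>L(1)\<omega> = 0\<close>, so of the sum that defines
  the opposite mode only the first term is left.\<close>

lemma virasoro_adjoint: "B (mode V \<omega> n x) y = B x (mode V \<omega> (2 - n) y)"
proof -
  have "(L V 1 ^^ Suc j) \<omega> = 0" for j
    by (induction j) (simp_all add: L_1_conformal, simp add: L_def mode_zero_right)
  then have 0: "(L V 1 ^^ j) \<omega> = 0" if "j \<noteq> 0" for j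
    using that by (cases j) auto
  have "opposite_mode V 2 \<omega> n y = mode V \<omega> (2 - n) y"
  proof -
    have *: "(1 / fact j) \<bullet> mode V ((L V 1 ^^ j) \<omega>) (2 * 2 - n - 2 - int j) y =
        (if j = 0 then mode V \<omega> (2 - n) y else 0)" for j
      by (cases "j = 0") (simp_all add: 0 mode_zero_left)
    show ?thesis
      unfolding opposite_mode_def *
      by (subst Sum_any.expand_superset[of "{0}"]) auto
  qed
  then show ?thesis
    using form_invariant conformal_weight unfolding invariant_def by metis
qed

lemma wt_space_iff: "x \<in> wt_space V k \<longleftrightarrow> mode V \<omega> 1 x = of_int k \<bullet> x"
  by (simp add: wt_space_def L_def)

lemma form_zero_weights:
  assumes "x \<in> wt_space V j" "y \<in> wt_space V k" "j \<noteq> k"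
  shows "B x y = 0"
proof -
  have "of_int j * B x y = of_int k * B x y"
    using virasoro_adjoint[of 1 x y] assms(1,2)
    by (simp add: wt_space_iff form_scale_left form_scale_right)
  then show ?thesis using assms(3) by simp
qed

lemma vacuum_weight: "vacuum_vector \<in> wt_space V 0"
  by (simp add: wt_space_iff creation)

lemma mode_weight:
  assumes "u \<in> wt_space V h" "v \<in> wt_space V k"
  shows "mode V u n v \<in> wt_space V (h + k - n - 1)"
proof -
  have "mode V \<omega> 1 (mode V u n v) = mode V u n (mode V \<omega> 1 v) +
      (mode V (mode V \<omega> 0 u) (1 + n) v + mode V (mode V \<omega> 1 u) n v)"
    using commutator_formula[of \<omega> 1 u n v] by (simp add: add.commute)
  \<comment> \<open>The weights \<open>k\<close> and \<open>h\<close> come from \<open>L(0)\<close>, the shift \<open>- n - 1\<close> from \<open>L(-1)\<close> as a derivative.\<close>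
  also have "mode V \<omega> 0 u = L V (-1) u"
    by (simp add: L_def)
  also have "mode V (L V (-1) u) (1 + n) v = (- of_int (1 + n)) \<bullet> mode V u n v"
    by (simp add: translation)
  also have "mode V u n (mode V \<omega> 1 v) = of_int k \<bullet> mode V u n v"
    using assms by (simp add: wt_space_iff mode_scale_right)
  also have "mode V (mode V \<omega> 1 u) n v = of_int h \<bullet> mode V u n v"
    using assms by (simp add: wt_space_iff mode_scale_left)
  finally show ?thesis
    by (simp add: wt_space_iff scale_left_distrib scale_left_diff_distrib)
qed

text \<open>A list of labels is kept apart from the vectors \<open>u\<close> and exponents \<open>m\<close> attached to them, so that
  replacing the vector at one label is a function update.\<close>

abbreviation word :: "(int \<Rightarrow> 'v) \<Rightarrow> (int \<Rightarrow> int) \<Rightarrow> int list \<Rightarrow> 'v \<Rightarrow> 'v" where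
  "word u m as \<equiv> foldr (\<lambda>a. mode V (u a) (- m a - 1)) as"

definition correlation :: "(int \<Rightarrow> 'v) \<Rightarrow> int list \<Rightarrow> formal_series" where
  "correlation u as m =
    (if \<forall>a. a \<notin> set as \<longrightarrow> m a = 0 then B vacuum_vector (word u m as vacuum_vector) else 0)"

lemma matrix_element_eq_correlation:
  "matrix_element V B (map (\<lambda>a. (u a, a)) as) = correlation u as"
proof
  fix m
  have "snd ` set (map (\<lambda>a. (u a, a)) as) = set as"
    by (auto simp: image_iff)
  moreover have "foldr (\<lambda>(v, a). mode V v (- m a - 1)) (map (\<lambda>a. (u a, a)) as) = word u m as"
    by (induction as) auto
  ultimately show "matrix_element V B (map (\<lambda>a. (u a, a)) as) m = correlation u as m"
    by (simp only: matrix_element_def correlation_def)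
qed

lemma word_sum:
  "word u m as (\<Sum>s\<in>S. c s \<bullet> x s) = (\<Sum>s\<in>S. c s \<bullet> word u m as (x s))"
  by (induction as) (simp_all add: mode_sum_right mode_scale_right)

lemma word_scale: "word u m as (c \<bullet> x) = c \<bullet> word u m as x"
  by (induction as) (simp_all add: mode_scale_right)

lemma word_zero: "word u m as 0 = 0"
  by (induction as) (simp_all add: mode_zero_right)

lemma word_cong:
  "(\<And>a. a \<in> set as \<Longrightarrow> u a = u' a \<and> m a = m' a) \<Longrightarrow> word u m as w = word u' m' as w"
  by (induction as) simp_all

lemma word_update:
  assumes "a \<notin> set ys" "a \<notin> set zs"
  shows "word (u(a := v)) (m(a := k)) (ys @ a # zs) w =
    word u m ys (mode V v (- k - 1) (word u m zs w))"
proof -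
  have "word (u(a := v)) (m(a := k)) xs w = word u m xs w" if "a \<notin> set xs" for xs w
    by (rule word_cong) (use that in auto)
  then show ?thesis
    using assms by simp
qed

lemma word_weight:
  assumes "\<And>a. a \<in> set as \<Longrightarrow> u a \<in> wt_space V (h a)"
  shows "word u m as vacuum_vector \<in> wt_space V (\<Sum>a\<leftarrow>as. h a + m a)"
  using assms
proof (induction as)
  case Nil
  then show ?case by (simp add: vacuum_weight)
next
  case (Cons a as)
  then have "mode V (u a) (- m a - 1) (word u m as vacuum_vector) \<in>
      wt_space V (h a + (\<Sum>a\<leftarrow>as. h a + m a) - (- m a - 1) - 1)"
    by (intro mode_weight) auto
  then show ?case
    by (simp add: algebra_simps)
qed

text \<open>The form pairs the vacuum to zero with every vector of non-zero weight.\<close>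

lemma correlation_homogeneous:
  assumes "distinct as" "\<And>a. a \<in> set as \<Longrightarrow> u a \<in> wt_space V (h a)"
  shows "homogeneous_series (set as) (- sum h (set as)) (correlation u as)"
  unfolding homogeneous_series_def
proof (intro allI impI)
  fix m assume *: "correlation u as m \<noteq> 0"
  then have supp: "\<forall>a. a \<notin> set as \<longrightarrow> m a = 0" and nz: "B vacuum_vector (word u m as vacuum_vector) \<noteq> 0"
    by (auto simp: correlation_def split: if_splits)
  have "(\<Sum>a\<leftarrow>as. h a + m a) = 0"
    using form_zero_weights[OF vacuum_weight word_weight[of as u h m]] assms(2) nz by auto
  also have "(\<Sum>a\<leftarrow>as. h a + m a) = sum h (set as) + sum m (set as)"
    using assms(1) by (simp add: sum_list_distinct_conv_sum_set sum.distrib)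
  finally show "(\<forall>a. a \<notin> set as \<longrightarrow> m a = 0) \<and> sum m (set as) = - sum h (set as)"
    using supp by simp
qed

text \<open>Two neighbouring vertex operators commute after multiplication with the power of the difference
  of their variables that locality provides.\<close>

lemma correlation_exchange:
  assumes "distinct (ys @ a # b # zs)"
  shows "\<exists>Q. degree_shifting (set (ys @ a # b # zs)) Q \<and>
    mpoly_act Q (correlation u (ys @ a # b # zs)) = mpoly_act Q (correlation u (ys @ b # a # zs))"
proof -
  obtain N where N: "\<And>m n w.
    (\<Sum>i\<le>N. ((-1) ^ i * of_nat (N choose i)) \<bullet> mode V (u a) (m + int N - int i) (mode V (u b) (n + int i) w)) =
    (\<Sum>i\<le>N. ((-1) ^ i * (-1) ^ N * of_nat (N choose i)) \<bullet>
      mode V (u b) (n + int N - int i) (mode V (u a) (m + int i) w))"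
    using locality[of "u a" "u b"] by blast
  have ab: "a \<noteq> b" "a \<notin> set ys" "a \<notin> set zs" "b \<notin> set ys" "b \<notin> set zs"
    using assms by auto
  let ?Q = "(mvar a - mvar b) ^ N"
  have "mpoly_act ?Q (correlation u (ys @ a # b # zs)) m = mpoly_act ?Q (correlation u (ys @ b # a # zs)) m" for m
  proof (cases "\<forall>x. x \<notin> set (ys @ a # b # zs) \<longrightarrow> m x = 0")
    case False
    then obtain x where x: "x \<notin> set (ys @ a # b # zs)" "m x \<noteq> 0" by blast
    then have "correlation u (ys @ a # b # zs) (m(a := k, b := l)) = 0"
      "correlation u (ys @ b # a # zs) (m(a := k, b := l)) = 0" for k l
      unfolding correlation_def by (auto intro!: exI[of _ x])
    then show ?thesis
      by (simp add: mpoly_act_diff_power[OF ab(1)])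
  next
    case True
    let ?w = "word u m zs vacuum_vector"
    let ?G = "\<lambda>x. B vacuum_vector (word u m ys x)"
    have G: "(\<Sum>i\<le>N. c i * ?G (x i)) = ?G (\<Sum>i\<le>N. c i \<bullet> x i)" for c x
      by (simp add: word_sum form_sum_right form_scale_right)
    have w: "word u (m(a := k, b := l)) xs w = word u m xs w" if "a \<notin> set xs" "b \<notin> set xs" for k l xs w
      by (rule word_cong) (use that in auto)
    have upd: "correlation u (ys @ a # b # zs) (m(a := k, b := l)) =
          ?G (mode V (u a) (- k - 1) (mode V (u b) (- l - 1) ?w)) \<and>
        correlation u (ys @ b # a # zs) (m(a := k, b := l)) =
          ?G (mode V (u b) (- l - 1) (mode V (u a) (- k - 1) ?w))" for k l
    proof -
      define m' where "m' = m(a := k, b := l)"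
      have "m' a = k" "m' b = l" "\<And>x. x \<notin> set (ys @ a # b # zs) \<Longrightarrow> m' x = 0"
        using True ab by (auto simp: m'_def)
      moreover have "word u m' ys x = word u m ys x" "word u m' zs vacuum_vector = ?w" for x
        unfolding m'_def by (simp_all only: w[OF ab(2,4)] w[OF ab(3,5)])
      ultimately show ?thesis
        unfolding m'_def[symmetric] correlation_def by simp
    qed
    note 1 = upd[THEN conjunct1] and 2 = upd[THEN conjunct2]
    let ?m = "- m a - 1" and ?n = "- m b - 1"
    have "mpoly_act ?Q (correlation u (ys @ a # b # zs)) m =
      (\<Sum>i\<le>N. ((-1) ^ i * of_nat (N choose i)) *
        ?G (mode V (u a) (?m + int N - int i) (mode V (u b) (?n + int i) ?w)))"
      unfolding mpoly_act_diff_power[OF ab(1)] 1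
      by (intro sum.cong refl) (simp add: of_nat_diff algebra_simps)
    also have "\<dots> = ?G (\<Sum>i\<le>N. ((-1) ^ i * (-1) ^ N * of_nat (N choose i)) \<bullet>
        mode V (u b) (?n + int N - int i) (mode V (u a) (?m + int i) ?w))"
      unfolding G N ..
    also have "\<dots> = (\<Sum>i\<le>N. ((-1) ^ i * (-1) ^ N * of_nat (N choose i)) *
        ?G (mode V (u b) (?n + int N - int i) (mode V (u a) (?m + int i) ?w)))"
      by (simp only: G)
    also have "\<dots> = (\<Sum>i\<le>N. ((-1) ^ (N - i) * (-1) ^ N * of_nat (N choose (N - i))) *
        ?G (mode V (u b) (?n + int N - int (N - i)) (mode V (u a) (?m + int (N - i)) ?w)))"
      by (rule sum.nat_diff_reindex[of _ "Suc N", simplified lessThan_Suc_atMost, simplified, symmetric])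
    also have "\<dots> = (\<Sum>i\<le>N. ((-1) ^ i * of_nat (N choose i)) *
        ?G (mode V (u b) (?n + int i) (mode V (u a) (?m + int N - int i) ?w)))"
    proof (intro sum.cong refl)
      fix i assume "i \<in> {..N}"
      then have i: "i \<le> N" by simp
      have "(-1) ^ (N - i) * (-1) ^ N = ((-1) ^ i :: complex)"
        using i by (simp add: power_add[symmetric] uminus_power_if)
      then show "((-1) ^ (N - i) * (-1) ^ N * of_nat (N choose (N - i))) *
        ?G (mode V (u b) (?n + int N - int (N - i)) (mode V (u a) (?m + int (N - i)) ?w)) =
        ((-1) ^ i * of_nat (N choose i)) *
        ?G (mode V (u b) (?n + int i) (mode V (u a) (?m + int N - int i) ?w))"
        using i by (simp add: of_nat_diff binomial_symmetric[symmetric] algebra_simps)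
    qed
    also have "\<dots> = mpoly_act ?Q (correlation u (ys @ b # a # zs)) m"
      unfolding mpoly_act_diff_power[OF ab(1)] 2
      by (intro sum.cong refl) (simp add: of_nat_diff algebra_simps)
    finally show ?thesis .
  qed
  moreover have "degree_shifting (set (ys @ a # b # zs)) ?Q"
    using ab by (intro degree_shifting_power degree_shifting_diff) auto
  ultimately show ?thesis by blast
qed

lemma correlation_move_last:
  assumes "distinct (ys @ a # zs)"
  shows "\<exists>Q. degree_shifting (set (ys @ a # zs)) Q \<and>
    mpoly_act Q (correlation u (ys @ a # zs)) = mpoly_act Q (correlation u (ys @ zs @ [a]))"
  using assms
proof (induction zs arbitrary: ys)
  case Nil
  then show ?case using degree_shifting_one by auto
next
  case (Cons b zs)
  have s: "set ((ys @ [b]) @ a # zs) = set (ys @ a # b # zs)" by auto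
  obtain Q where Q: "degree_shifting (set (ys @ a # b # zs)) Q"
    "mpoly_act Q (correlation u (ys @ a # b # zs)) = mpoly_act Q (correlation u (ys @ b # a # zs))"
    using correlation_exchange[OF Cons.prems] by blast
  obtain Q' where Q': "degree_shifting (set (ys @ a # b # zs)) Q'"
    "mpoly_act Q' (correlation u (ys @ b # a # zs)) = mpoly_act Q' (correlation u (ys @ b # zs @ [a]))"
    using Cons.IH[of "ys @ [b]"] Cons.prems unfolding s by auto
  have "mpoly_act (Q * Q') (correlation u (ys @ a # b # zs)) =
      mpoly_act (Q * Q') (correlation u (ys @ b # zs @ [a]))"
    using Q(2) Q'(2) by (metis mpoly_act_mult mpoly_act_commute)
  then show ?case
    using degree_shifting_mult[OF Q(1) Q'(1)] by auto
qed

text \<open>The creation property: \<open>Y(v,y)\<one>\<close> has no negative powers of \<open>y\<close>.\<close>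

lemma correlation_nonneg_last:
  assumes "correlation u (xs @ [a]) m \<noteq> 0"
  shows "m a \<ge> 0"
proof (rule ccontr)
  assume "\<not> m a \<ge> 0"
  then have "mode V (u a) (- m a - 1) vacuum_vector = 0"
    by (intro creation) simp
  then show False
    using assms by (simp add: correlation_def word_zero form_zero_right split: if_splits)
qed

text \<open>For each label a product of differences lets its operator act first, which removes the negative
  exponents of its variable; they do not come back under further multiplication with polynomials.\<close>

lemma correlation_clear_poles:
  assumes "distinct as" "A \<subseteq> set as"
  shows "\<exists>Q. degree_shifting (set as) Q \<and>
    (\<forall>a\<in>A. \<forall>m. mpoly_act Q (correlation u as) m \<noteq> 0 \<longrightarrow> m a \<ge> 0)"
proof -
  have "finite A" using assms(2) finite_subset by blast
  then show ?thesis using assms(2)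
  proof (induction A rule: finite_induct)
    case empty
    then show ?case using degree_shifting_one by blast
  next
    case (insert a A)
    then obtain Q where Q: "degree_shifting (set as) Q"
      "\<And>b m. b \<in> A \<Longrightarrow> mpoly_act Q (correlation u as) m \<noteq> 0 \<Longrightarrow> m b \<ge> 0"
      by blast
    obtain ys zs where as: "as = ys @ a # zs"
      using insert.prems by (meson insert_subset split_list)
    obtain Q' where Q': "degree_shifting (set as) Q'"
      "mpoly_act Q' (correlation u as) = mpoly_act Q' (correlation u (ys @ zs @ [a]))"
      using correlation_move_last assms(1) unfolding as by blast
    have "m a \<ge> 0" if "mpoly_act Q' (correlation u as) m \<noteq> 0" for m
    proof (rule mpoly_act_nonneg[where m = m and a = a and Q = Q' and F = "correlation u (ys @ zs @ [a])"])
      show "mpoly_act Q' (correlation u (ys @ zs @ [a])) m \<noteq> 0"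
        using that unfolding Q'(2) .
      show "m a \<ge> 0" if "correlation u (ys @ zs @ [a]) m \<noteq> 0" for m
        using that correlation_nonneg_last[of u "ys @ zs" a m] by simp
    qed
    then have "m b \<ge> 0" if "b \<in> insert a A" "mpoly_act (Q * Q') (correlation u as) m \<noteq> 0" for m b
      using that Q(2) mpoly_act_nonneg[of "mpoly_act Q' (correlation u as)" a Q m]
        mpoly_act_nonneg[of "mpoly_act Q (correlation u as)" b Q' m]
        mpoly_act_commute[of Q Q' "correlation u as"]
      by (auto simp: mpoly_act_mult)
    then show ?case
      using degree_shifting_mult[OF Q(1) Q'(1)] by blast
  qed
qed

definition Z :: "(int \<Rightarrow> 'v) \<Rightarrow> int list \<Rightarrow> ratfun" where
  "Z u as = Z0 V B (map (\<lambda>a. (u a, a)) as)"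

lemma Z_eqI: "has_extension (correlation u as) R \<Longrightarrow> Z u as = R"
  by (simp add: Z_def Z0_def matrix_element_eq_correlation rational_extension_eq)

definition homogeneous_on :: "int set \<Rightarrow> (int \<Rightarrow> 'v) \<Rightarrow> bool" where
  "homogeneous_on A u \<longleftrightarrow> (\<forall>a\<in>A. \<exists>h. u a \<in> wt_space V h)"

theorem correlation_rational:
  assumes "distinct as" "homogeneous_on (set as) u"
  shows "has_extension (correlation u as) (Z u as)"
proof -
  obtain h where h: "\<And>a. a \<in> set as \<Longrightarrow> u a \<in> wt_space V (h a)"
    using assms(2) unfolding homogeneous_on_def by metis
  obtain Q where Q: "degree_shifting (set as) Q"
    "\<And>a m. a \<in> set as \<Longrightarrow> mpoly_act Q (correlation u as) m \<noteq> 0 \<Longrightarrow> m a \<ge> 0"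
    using correlation_clear_poles[OF assms(1) subset_refl] by blast
  then obtain e where "homogeneous_series (set as) (- sum h (set as) + e) (mpoly_act Q (correlation u as))"
    using correlation_homogeneous[of as u h, OF assms(1) h] unfolding degree_shifting_def by blast
  then obtain P where "mpoly_act Q (correlation u as) = mpoly_act P one_series"
    using homogeneous_nonneg_polynomial[of "set as"] Q(2) by blast
  then have "has_extension (correlation u as) (Fract P Q)"
    using Q(1) unfolding degree_shifting_def by (blast intro: has_extensionI)
  then show ?thesis
    using Z_eqI by metis
qed

text \<open>Since \<open>v\<^sub>n\<close> with \<open>n = - m - 1\<close> is the coefficient of \<open>y\<^sup>m\<close>, the mode with index \<open>n + j - i\<close> in the
  commutator formula belongs to the exponent \<open>m - (j - i)\<close>, that is, to multiplication by \<open>y\<^bsup>j-i\<^esup>\<close>.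
  No term is left at the right end because \<open>\<omega>\<^sub>j \<one> = 0\<close>.\<close>

lemma ward_word:
  assumes "distinct as"
  shows "mode V \<omega> (int j) (word u m as vacuum_vector) =
    (\<Sum>a\<in>set as. \<Sum>i\<le>j. of_nat (j choose i) \<bullet>
      word (u(a := mode V \<omega> (int i) (u a))) (m(a := m a - int (j - i))) as vacuum_vector)"
  using assms
proof (induction as)
  case Nil
  then show ?case by (simp add: creation)
next
  case (Cons x xs)
  let ?t = "\<lambda>as a i. of_nat (j choose i) \<bullet>
      word (u(a := mode V \<omega> (int i) (u a))) (m(a := m a - int (j - i))) as vacuum_vector"
  let ?w = "word u m xs vacuum_vector"
  have x: "(\<Sum>i\<le>j. ?t (x # xs) x i) =
      (\<Sum>i\<le>j. of_nat (j choose i) \<bullet>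
        mode V (mode V \<omega> (int i) (u x)) (int j + (- m x - 1) - int i) ?w)"
  proof (intro sum.cong refl)
    fix i assume "i \<in> {..j}"
    then show "?t (x # xs) x i = of_nat (j choose i) \<bullet>
        mode V (mode V \<omega> (int i) (u x)) (int j + (- m x - 1) - int i) ?w"
      using word_update[of x "[]" xs u _ m "m x - int (j - i)"] Cons.prems
      by (simp add: of_nat_diff algebra_simps)
  qed
  have xs: "?t (x # xs) a i = mode V (u x) (- m x - 1) (?t xs a i)" if "a \<in> set xs" for a i
  proof -
    have "a \<noteq> x" using that Cons.prems by auto
    then show ?thesis by (simp add: mode_scale_right)
  qed
  have "mode V \<omega> (int j) (word u m (x # xs) vacuum_vector) =
      mode V (u x) (- m x - 1) (mode V \<omega> (int j) ?w) + (\<Sum>i\<le>j. ?t (x # xs) x i)"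
    unfolding x by (simp only: foldr.simps comp_apply commutator_formula)
  also have "mode V (u x) (- m x - 1) (mode V \<omega> (int j) ?w) =
      (\<Sum>a\<in>set xs. \<Sum>i\<le>j. ?t (x # xs) a i)"
    unfolding Cons.IH[OF distinct_tl[OF Cons.prems, simplified]] mode_sum_right
    by (intro sum.cong refl) (simp only: xs)
  finally show ?case
    using Cons.prems by (simp add: add.commute)
qed

text \<open>For \<open>j \<le> 2\<close> the adjoint \<open>\<omega>\<^bsub>2-j\<^esub>\<close> of \<open>\<omega>\<^sub>j\<close> annihilates the vacuum as well. This is where the degree
  bound on the polynomial \<open>p\<close> comes from.\<close>

lemma ward_correlation:
  assumes "distinct as" "j \<le> 2"
  shows "(\<Sum>a\<in>set as. \<Sum>i\<le>j. of_nat (j choose i) *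
    correlation (u(a := mode V \<omega> (int i) (u a))) as (m(a := m a - int (j - i)))) = 0"
proof (cases "\<forall>a. a \<notin> set as \<longrightarrow> m a = 0")
  case True
  have "(\<Sum>a\<in>set as. \<Sum>i\<le>j. of_nat (j choose i) *
    correlation (u(a := mode V \<omega> (int i) (u a))) as (m(a := m a - int (j - i)))) =
    (\<Sum>a\<in>set as. \<Sum>i\<le>j. B vacuum_vector (of_nat (j choose i) \<bullet>
      word (u(a := mode V \<omega> (int i) (u a))) (m(a := m a - int (j - i))) as vacuum_vector))"
    using True by (intro sum.cong refl) (auto simp only: correlation_def form_scale_right fun_upd_apply split: if_splits)
  also have "\<dots> = B vacuum_vector (mode V \<omega> (int j) (word u m as vacuum_vector))"
    by (simp only: ward_word[OF assms(1)] form_sum_right)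
  also have "\<dots> = B (mode V \<omega> (2 - int j) vacuum_vector) (word u m as vacuum_vector)"
    by (simp add: virasoro_adjoint)
  also have "\<dots> = 0"
    using assms(2) by (simp add: creation form_zero_left)
  finally show ?thesis .
next
  case False
  then obtain x where "x \<notin> set as" "m x \<noteq> 0" by blast
  then have "correlation u' as (m(a := k)) = 0" if "a \<in> set as" for u' a k
    using that unfolding correlation_def by auto
  then show ?thesis by simp
qed

lemma homogeneous_update_mode:
  assumes "homogeneous_on A u" "a \<in> A" "v \<in> wt_space V k"
  shows "homogeneous_on A (u(a := mode V v n (u a)))"
  using assms mode_weight unfolding homogeneous_on_def fun_upd_apply by metis

lemma ward_Z:
  assumes "distinct as" "homogeneous_on (set as) u" "j \<le> 2"
  shows "(\<Sum>a\<in>set as. \<Sum>i\<le>j. of_nat (j choose i) *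
    (var a ^ (j - i) * Z (u(a := L V (int i - 1) (u a))) as)) = 0"
proof -
  have "has_extension (\<lambda>m. \<Sum>a\<in>set as. \<Sum>i\<le>j. of_nat (j choose i) *
      correlation (u(a := mode V \<omega> (int i) (u a))) as (m(a := m a - int (j - i))))
    (\<Sum>a\<in>set as. \<Sum>i\<le>j. const (of_nat (j choose i)) *
      (var a ^ (j - i) * Z (u(a := mode V \<omega> (int i) (u a))) as))"
    by (intro has_extension_sum has_extension_scale has_extension_var_power correlation_rational
        homogeneous_update_mode[OF _ _ conformal_weight] assms)
  then have "has_extension (\<lambda>_. 0) (\<Sum>a\<in>set as. \<Sum>i\<le>j. const (of_nat (j choose i)) *
      (var a ^ (j - i) * Z (u(a := mode V \<omega> (int i) (u a))) as))"
    by (simp only: ward_correlation[OF assms(1,3)])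
  then have "(\<Sum>a\<in>set as. \<Sum>i\<le>j. const (of_nat (j choose i)) *
      (var a ^ (j - i) * Z (u(a := mode V \<omega> (int i) (u a))) as)) = 0"
    by (rule has_extension_unique[OF _ has_extension_zero])
  then show ?thesis
    by (simp add: const_of_nat L_def)
qed

lemma correlation_update:
  assumes "a \<notin> set ys" "a \<notin> set zs"
  shows "correlation (u(a := v)) (ys @ a # zs) (m(a := k)) =
    of_bool (\<forall>b. b \<notin> set (ys @ a # zs) \<longrightarrow> m b = 0) *
      B vacuum_vector (word u m ys (mode V v (- k - 1) (word u m zs vacuum_vector)))"
proof -
  have "(\<forall>b. b \<notin> set (ys @ a # zs) \<longrightarrow> (m(a := k)) b = 0) = (\<forall>b. b \<notin> set (ys @ a # zs) \<longrightarrow> m b = 0)"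
    by auto
  then show ?thesis
    unfolding correlation_def word_update[OF assms]
    by (simp only: of_bool_def if_distrib[of "\<lambda>x. x * _"] mult_zero_left mult_1_left)
qed

lemma correlation_sum:
  assumes "distinct as" "a \<in> set as"
  shows "correlation (u(a := \<Sum>s\<in>S. c s \<bullet> f s)) as m =
    (\<Sum>s\<in>S. c s * correlation (u(a := f s)) as m)"
proof -
  obtain ys zs where as: "as = ys @ a # zs"
    using assms(2) by (meson split_list)
  then have "a \<notin> set ys" "a \<notin> set zs"
    using assms(1) by auto
  note upd = correlation_update[OF this, of u _ m "m a", unfolded fun_upd_triv]
  show ?thesis
    unfolding as upd
    by (simp only: mode_sum_left mode_scale_left word_sum form_sum_right form_scale_right
        sum_distrib_left mult.left_commute)
qed

lemma correlation_scale:
  assumes "distinct as" "a \<in> set as"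
  shows "correlation (u(a := c \<bullet> v)) as m = c * correlation (u(a := v)) as m"
  using correlation_sum[OF assms, of u "\<lambda>_. c" "\<lambda>_. v" "{()}" m] by simp

lemma Z_translation:
  assumes "distinct as" "homogeneous_on (set as) u" "a \<in> set as"
  shows "Z (u(a := L V (-1) (u a))) as = pdiff a (Z u as)"
proof (rule Z_eqI)
  have "correlation (u(a := L V (-1) (u a))) as m = formal_deriv a (correlation u as) m" for m
  proof -
    obtain ys zs where as: "as = ys @ a # zs"
      using assms(3) by (meson split_list)
    then have "a \<notin> set ys" "a \<notin> set zs"
      using assms(1) by auto
    note upd = correlation_update[OF this, of u]
    have "mode V (L V (-1) (u a)) (- m a - 1) x =
        of_int (m a + 1) \<bullet> mode V (u a) (- (m a + 1) - 1) x" for x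
      by (simp add: translation)
    then show ?thesis
      using upd[of "L V (-1) (u a)" m "m a"] upd[of "u a" m "m a + 1"]
      unfolding formal_deriv_def as fun_upd_triv
      by (simp only: word_scale form_scale_right mult.left_commute)
  qed
  then have "correlation (u(a := L V (-1) (u a))) as = formal_deriv a (correlation u as)"
    by (rule ext)
  then show "has_extension (correlation (u(a := L V (-1) (u a))) as) (pdiff a (Z u as))"
    using has_extension_pdiff[OF correlation_rational[OF assms(1,2)]] by (simp only:)
qed

lemma Z_weight:
  assumes "distinct as" "homogeneous_on (set as) u" "a \<in> set as" "u a \<in> wt_space V h"
  shows "Z (u(a := L V 0 (u a))) as = const (of_int h) * Z u as"
proof (rule Z_eqI)
  have "correlation (u(a := L V 0 (u a))) as = (\<lambda>m. of_int h * correlation u as m)"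
    using assms(4) correlation_scale[OF assms(1,3), of u "of_int h" "u a"]
    by (simp add: wt_space_def fun_eq_iff)
  then show "has_extension (correlation (u(a := L V 0 (u a))) as) (const (of_int h) * Z u as)"
    using has_extension_scale[OF correlation_rational[OF assms(1,2)]] by simp
qed

lemma Z_zero:
  assumes "distinct as" "a \<in> set as"
  shows "Z (u(a := 0)) as = 0"
proof (rule Z_eqI)
  have "correlation (u(a := 0)) as = (\<lambda>_. 0)"
    using correlation_scale[OF assms, of u 0 0] by (simp add: fun_eq_iff)
  then show "has_extension (correlation (u(a := 0)) as) 0"
    using has_extension_zero by simp
qed

lemma poly_at_quadratic:
  "poly_at [:c0, c1, c2:] a = const c0 + const c1 * var a + const c2 * var a ^ 2"
proof -
  have "map_poly const [:c0, c1, c2:] = [:const c0, const c1, const c2:]"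
    by (simp add: map_poly_pCons const_zero)
  then show ?thesis
    by (simp add: poly_at_def power2_eq_square algebra_simps)
qed

lemma const_add: "const (c + d) = const c + const d"
  by (simp add: const_def single_add)

text \<open>For \<open>p = c\<^sub>0 + c\<^sub>1 x + c\<^sub>2 x\<^sup>2\<close>, the combination with coefficients \<open>c\<^sub>0, c\<^sub>1, c\<^sub>2\<close> of the identities for
  \<open>L(-1), L(0), L(1)\<close>.\<close>

lemma ward_identity:
  assumes "distinct as" "\<And>a. a \<in> set as \<Longrightarrow> u a \<in> wt_space V (h a)" "degree p \<le> 2"
  shows "(\<Sum>a\<in>set as. poly_at p a * pdiff a (Z u as) +
    poly_at (divided_deriv 1 p) a * (const (of_int (h a)) * Z u as) +
    poly_at (divided_deriv 2 p) a * Z (u(a := L V 1 (u a))) as) = 0"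
proof -
  define D where "D a = pdiff a (Z u as)" for a
  define W where "W a = const (of_int (h a)) * Z u as" for a
  define E where "E a = Z (u(a := L V 1 (u a))) as" for a
  have hom: "homogeneous_on (set as) u"
    using assms(2) unfolding homogeneous_on_def by blast
  note w = ward_Z[OF assms(1) hom]
  have 0: "(\<Sum>a\<in>set as. D a) = 0"
    using w[of 0] Z_translation[OF assms(1) hom] by (simp add: D_def)
  have 1: "(\<Sum>a\<in>set as. var a * D a + W a) = 0"
    using w[of 1] Z_translation[OF assms(1) hom] Z_weight[OF assms(1) hom _ assms(2)]
    by (simp add: D_def W_def)
  have 2: "(\<Sum>a\<in>set as. var a ^ 2 * D a + 2 * var a * W a + E a) = 0"
    using w[of 2] Z_translation[OF assms(1) hom] Z_weight[OF assms(1) hom _ assms(2)]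
    by (simp add: D_def W_def E_def numeral_2_eq_2 algebra_simps)
  obtain c0 c1 c2 where p: "p = [:c0, c1, c2:]"
  proof
    show "p = [:coeff p 0, coeff p 1, coeff p 2:]"
      using assms(3) by (intro poly_eqI) (auto simp: coeff_pCons coeff_eq_0 numeral_2_eq_2 split: nat.split)
  qed
  have d1: "divided_deriv 1 p = [:c1, c2 + c2, 0:]" and d2: "divided_deriv 2 p = [:c2, 0, 0:]"
    by (simp_all add: divided_deriv_def p pderiv_pCons numeral_2_eq_2)
  have "(\<Sum>a\<in>set as. poly_at p a * D a + poly_at (divided_deriv 1 p) a * W a +
      poly_at (divided_deriv 2 p) a * E a) =
    const c0 * (\<Sum>a\<in>set as. D a) + const c1 * (\<Sum>a\<in>set as. var a * D a + W a) +
    const c2 * (\<Sum>a\<in>set as. var a ^ 2 * D a + 2 * var a * W a + E a)"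
    unfolding d1 d2 unfolding p poly_at_quadratic const_add const_zero sum_distrib_left sum.distrib[symmetric]
    by (intro sum.cong refl) (simp add: algebra_simps)
  also have "\<dots> = 0"
    by (simp only: 0 1 2 mult_zero_right add_0_left)
  finally show ?thesis
    unfolding D_def W_def E_def .
qed

section \<open>Contraction of dual bases\<close>

definition dual_bases :: "'v set \<Rightarrow> ('v \<Rightarrow> 'v) \<Rightarrow> bool" where
  "dual_bases S d \<longleftrightarrow> homogeneous_basis S \<and>
     (\<forall>b\<in>S. \<forall>c\<in>S. B b (d c) = (if b = c then 1 else 0))"

lemma eq_zero_if_orthogonal_to_basis:
  assumes "homogeneous_basis S" "\<And>b. b \<in> S \<Longrightarrow> B b x = 0"
  shows "x = 0"
proof -
  have "B v x = 0" for v
  proof -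
    have "v \<in> span S"
      using assms(1) by (simp add: homogeneous_basis_def)
    then show ?thesis
    proof (rule span_induct)
      show "subspace {v. B v x = 0}"
        by (simp add: subspace_def form_zero_left form_add_left form_scale_left)
    qed (use assms(2) in simp)
  qed
  then show ?thesis
    using form_nondegenerate unfolding nondegenerate_def by blast
qed

lemma basis_vector_homogeneous:
  assumes "homogeneous_basis S" "b \<in> S"
  obtains j where "b \<in> wt_space V j"
  using assms unfolding homogeneous_basis_def by blast

text \<open>The vector \<open>L(0) d(c) - k d(c)\<close> is orthogonal to the basis, because \<open>L(0)\<close> is self-adjoint.\<close>

lemma dual_weight:
  assumes "dual_bases S d" "c \<in> S" "c \<in> wt_space V k"
  shows "d c \<in> wt_space V k"
proof -
  have "mode V \<omega> 1 (d c) - of_int k \<bullet> d c = 0"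
  proof (rule eq_zero_if_orthogonal_to_basis)
    show S: "homogeneous_basis S" using assms(1) by (simp add: dual_bases_def)
    fix b assume b: "b \<in> S"
    then obtain j where j: "b \<in> wt_space V j"
      using basis_vector_homogeneous S by blast
    have "B b (mode V \<omega> 1 (d c)) = B (mode V \<omega> 1 b) (d c)"
      by (simp add: virasoro_adjoint)
    also have "\<dots> = of_int k * B b (d c)"
    proof (cases "b = c")
      case True
      then show ?thesis using assms(3) by (simp add: wt_space_iff form_scale_left)
    next
      case False
      then have "B b (d c) = 0"
        using assms(1,2) b by (simp add: dual_bases_def)
      then show ?thesis using j by (simp add: wt_space_iff form_scale_left)
    qed
    finally show "B b (mode V \<omega> 1 (d c) - of_int k \<bullet> d c) = 0"
      by (simp add: form_diff_right form_scale_right)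
  qed
  then show ?thesis by (simp add: wt_space_iff)
qed

lemma finite_weight_basis:
  assumes "homogeneous_basis S"
  shows "finite (S \<inter> wt_space V k)"
proof -
  obtain T where T: "finite T" "wt_space V k = span T"
    using finite_dim by blast
  have "independent (S \<inter> wt_space V k)"
    using assms independent_mono[of S] unfolding homogeneous_basis_def by blast
  then show ?thesis
    using independent_span_bound[OF T(1)] T(2) by blast
qed

lemma basis_expansion:
  assumes "dual_bases S d" "v \<in> wt_space V k"
  shows "v = (\<Sum>c\<in>S \<inter> wt_space V k. B v (d c) \<bullet> c)"
proof -
  have S: "homogeneous_basis S" and d: "\<And>b c. b \<in> S \<Longrightarrow> c \<in> S \<Longrightarrow> B b (d c) = (if b = c then 1 else 0)"
    using assms(1) by (simp_all add: dual_bases_def)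
  have "v \<in> span S" using S by (simp add: homogeneous_basis_def)
  then obtain T r where T: "finite T" "T \<subseteq> S" and v: "v = (\<Sum>b\<in>T. r b \<bullet> b)"
    unfolding span_explicit by blast
  have r: "B v (d c) = (if c \<in> T then r c else 0)" if "c \<in> S" for c
  proof -
    have "B v (d c) = (\<Sum>b\<in>T. r b * B b (d c))"
      unfolding v by (simp only: form_sum_left form_scale_left)
    also have "\<dots> = (\<Sum>b\<in>T. if b = c then r c else 0)"
      using T(2) that by (intro sum.cong refl) (auto simp: d)
    finally show ?thesis
      using T(1) by (simp add: sum.delta')
  qed
  have "v = (\<Sum>c\<in>T. B v (d c) \<bullet> c)"
    using r T(2) by (subst v) (auto intro!: sum.cong)
  also have "\<dots> = (\<Sum>c\<in>T \<union> (S \<inter> wt_space V k). B v (d c) \<bullet> c)"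
    using T(1) finite_weight_basis[OF S] r by (intro sum.mono_neutral_left) auto
  also have "\<dots> = (\<Sum>c\<in>S \<inter> wt_space V k. B v (d c) \<bullet> c)"
  proof (intro sum.mono_neutral_right ballI)
    fix c assume "c \<in> T \<union> (S \<inter> wt_space V k) - (S \<inter> wt_space V k)"
    then have c: "c \<in> S" "c \<notin> wt_space V k" using T(2) by auto
    then obtain j where j: "c \<in> wt_space V j"
      using basis_vector_homogeneous S by blast
    then have "k \<noteq> j" using c by auto
    then show "B v (d c) \<bullet> c = 0"
      using form_zero_weights[OF assms(2) dual_weight[OF assms(1) c(1) j]] by simp
  qed (use T(1) finite_weight_basis[OF S] in auto)
  finally show ?thesis .
qed

lemma dual_basis_expansion:
  assumes "dual_bases S d" "x \<in> wt_space V k"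
  shows "x = (\<Sum>c\<in>S \<inter> wt_space V k. B c x \<bullet> d c)"
proof -
  have S: "homogeneous_basis S" and d: "\<And>b c. b \<in> S \<Longrightarrow> c \<in> S \<Longrightarrow> B b (d c) = (if b = c then 1 else 0)"
    using assms(1) by (simp_all add: dual_bases_def)
  have "x - (\<Sum>c\<in>S \<inter> wt_space V k. B c x \<bullet> d c) = 0"
  proof (rule eq_zero_if_orthogonal_to_basis[OF S])
    fix b assume b: "b \<in> S"
    have "B b (\<Sum>c\<in>S \<inter> wt_space V k. B c x \<bullet> d c) = (\<Sum>c\<in>S \<inter> wt_space V k. B c x * B b (d c))"
      by (simp only: form_sum_right form_scale_right)
    also have "\<dots> = (\<Sum>c\<in>S \<inter> wt_space V k. if c = b then B b x else 0)"
      using b by (intro sum.cong refl) (auto simp: d)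
    also have "\<dots> = (if b \<in> wt_space V k then B b x else 0)"
      using b finite_weight_basis[OF S] by simp
    also have "\<dots> = B b x"
    proof (cases "b \<in> wt_space V k")
      case False
      obtain j where j: "b \<in> wt_space V j"
        using basis_vector_homogeneous[OF S b] .
      then have "j \<noteq> k" using False by auto
      then show ?thesis
        using form_zero_weights[OF j assms(2)] by simp
    qed simp
    finally show "B b (x - (\<Sum>c\<in>S \<inter> wt_space V k. B c x \<bullet> d c)) = 0"
      by (simp add: form_diff_right)
  qed
  then show ?thesis by simp
qed

lemma homogeneous_update2:
  assumes "homogeneous_on (A - {a, a'}) u" "x \<in> wt_space V j" "y \<in> wt_space V k"
  shows "homogeneous_on A (u(a := x, a' := y))"
  using assms unfolding homogeneous_on_def by auto

text \<open>The two sides are the images, under the bilinear dependence on the vectors at \<open>a\<close> and \<open>a'\<close>, of the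
  same tensor \<open>\<Sum>\<^sub>b\<^sub>,\<^sub>c M\<^sub>b\<^sub>c e(c) \<otimes> f(b)\<close>, summed in different orders.\<close>

lemma Z_exchange_sums:
  assumes "distinct as" "a \<in> set as" "a' \<in> set as" "a \<noteq> a'"
    and x: "\<And>b. b \<in> S \<Longrightarrow> x b = (\<Sum>c\<in>T. M b c \<bullet> e c)"
    and y: "\<And>c. c \<in> T \<Longrightarrow> y c = (\<Sum>b\<in>S. M b c \<bullet> f b)"
    and "\<And>b. b \<in> S \<Longrightarrow> homogeneous_on (set as) (u(a := x b, a' := f b))"
    and "\<And>c. c \<in> T \<Longrightarrow> homogeneous_on (set as) (u(a := e c, a' := y c))"
  shows "(\<Sum>b\<in>S. Z (u(a := x b, a' := f b)) as) = (\<Sum>c\<in>T. Z (u(a := e c, a' := y c)) as)"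
proof (rule has_extension_unique)
  let ?c = "\<lambda>b c. correlation (u(a := e c, a' := f b)) as"
  show "has_extension (\<lambda>m. \<Sum>b\<in>S. correlation (u(a := x b, a' := f b)) as m)
      (\<Sum>b\<in>S. Z (u(a := x b, a' := f b)) as)"
    using assms by (intro has_extension_sum correlation_rational)
  have l: "correlation (u(a := x b, a' := f b)) as m = (\<Sum>c\<in>T. M b c * ?c b c m)" if "b \<in> S" for b m
    unfolding x[OF that] fun_upd_twist[OF assms(4)] by (rule correlation_sum[OF assms(1,2)])
  have r: "correlation (u(a := e c, a' := y c)) as m = (\<Sum>b\<in>S. M b c * ?c b c m)" if "c \<in> T" for c m
    unfolding y[OF that] by (rule correlation_sum[OF assms(1,3)])
  have eq: "(\<Sum>b\<in>S. correlation (u(a := x b, a' := f b)) as m) =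
      (\<Sum>c\<in>T. correlation (u(a := e c, a' := y c)) as m)" for m
    by (simp add: l r) (rule sum.swap)
  show "has_extension (\<lambda>m. \<Sum>b\<in>S. correlation (u(a := x b, a' := f b)) as m)
      (\<Sum>c\<in>T. Z (u(a := e c, a' := y c)) as)"
    unfolding eq using assms by (intro has_extension_sum correlation_rational)
qed

lemma L_weight: "v \<in> wt_space V k \<Longrightarrow> L V n v \<in> wt_space V (k - n)"
  using mode_weight[OF conformal_weight, of v k "n + 1"] by (simp add: L_def algebra_simps)

lemma L_adjoint: "B (L V n x) y = B x (L V (- n) y)"
  by (simp add: L_def virasoro_adjoint)

context
  fixes S d as a a' u
  assumes dual: "dual_bases S d"
    and labels: "distinct as" "a \<in> set as" "a' \<in> set as" "a \<noteq> a'"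
    and hom: "homogeneous_on (set as - {a, a'}) u"
begin

text \<open>The coefficients of \<open>L(1) b\<close> in the basis and of \<open>L(-1) d(c)\<close> in the dual basis agree since \<open>L(1)\<close> and
  \<open>L(-1)\<close> are adjoint, and \<open>L(-1)\<close> at \<open>a'\<close> is the derivative with respect to that variable.\<close>

lemma contract_L1_left:
  "(\<Sum>b\<in>S \<inter> wt_space V k. Z (u(a := L V 1 b, a' := d b)) as) =
   (\<Sum>c\<in>S \<inter> wt_space V (k - 1). pdiff a' (Z (u(a := c, a' := d c)) as))"
proof -
  have "(\<Sum>b\<in>S \<inter> wt_space V k. Z (u(a := L V 1 b, a' := d b)) as) =
     (\<Sum>c\<in>S \<inter> wt_space V (k - 1). Z (u(a := c, a' := L V (-1) (d c))) as)"
  proof (rule Z_exchange_sums[OF labels, where M = "\<lambda>b c. B (L V 1 b) (d c)"])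
    fix b assume b: "b \<in> S \<inter> wt_space V k"
    show "L V 1 b = (\<Sum>c\<in>S \<inter> wt_space V (k - 1). B (L V 1 b) (d c) \<bullet> c)"
      using b by (intro basis_expansion[OF dual] L_weight) auto
    show "homogeneous_on (set as) (u(a := L V 1 b, a' := d b))"
      using b L_weight[of b k 1] dual_weight[OF dual, of b k] by (intro homogeneous_update2[OF hom]) auto
  next
    fix c assume c: "c \<in> S \<inter> wt_space V (k - 1)"
    then have w: "L V (-1) (d c) \<in> wt_space V k"
      using L_weight[of "d c" "k - 1" "-1"] dual_weight[OF dual, of c "k - 1"] by simp
    then show "L V (-1) (d c) = (\<Sum>b\<in>S \<inter> wt_space V k. B (L V 1 b) (d c) \<bullet> d b)"
      unfolding L_adjoint by (rule dual_basis_expansion[OF dual])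
    show "homogeneous_on (set as) (u(a := c, a' := L V (-1) (d c)))"
      using c w by (intro homogeneous_update2[OF hom]) auto
  qed
  also have "\<dots> = (\<Sum>c\<in>S \<inter> wt_space V (k - 1). pdiff a' (Z (u(a := c, a' := d c)) as))"
  proof (intro sum.cong refl)
    fix c assume "c \<in> S \<inter> wt_space V (k - 1)"
    then have "homogeneous_on (set as) (u(a := c, a' := d c))"
      using dual_weight[OF dual, of c "k - 1"] by (intro homogeneous_update2[OF hom]) auto
    from Z_translation[OF labels(1) this labels(3)]
    show "Z (u(a := c, a' := L V (-1) (d c))) as = pdiff a' (Z (u(a := c, a' := d c)) as)"
      by simp
  qed
  finally show ?thesis .
qed

lemma contract_L1_right:
  "(\<Sum>b\<in>S \<inter> wt_space V k. Z (u(a := b, a' := L V 1 (d b))) as) =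
   (\<Sum>c\<in>S \<inter> wt_space V (k - 1). pdiff a (Z (u(a := c, a' := d c)) as))"
proof -
  have hom': "homogeneous_on (set as - {a', a}) u"
    using hom by (simp add: insert_commute)
  have "(\<Sum>b\<in>S \<inter> wt_space V k. Z (u(a' := L V 1 (d b), a := b)) as) =
     (\<Sum>c\<in>S \<inter> wt_space V (k - 1). Z (u(a' := d c, a := L V (-1) c)) as)"
  proof (rule Z_exchange_sums[OF labels(1,3,2) labels(4)[symmetric], where M = "\<lambda>b c. B c (L V 1 (d b))"])
    fix b assume b: "b \<in> S \<inter> wt_space V k"
    then have w: "L V 1 (d b) \<in> wt_space V (k - 1)"
      using L_weight[of "d b" k 1] dual_weight[OF dual, of b k] by simp
    then show "L V 1 (d b) = (\<Sum>c\<in>S \<inter> wt_space V (k - 1). B c (L V 1 (d b)) \<bullet> d c)"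
      by (rule dual_basis_expansion[OF dual])
    show "homogeneous_on (set as) (u(a' := L V 1 (d b), a := b))"
      using b w by (intro homogeneous_update2[OF hom']) auto
  next
    fix c assume c: "c \<in> S \<inter> wt_space V (k - 1)"
    then have w: "L V (-1) c \<in> wt_space V k"
      using L_weight[of c "k - 1" "-1"] by simp
    have "B (L V (-1) c) (d b) = B c (L V 1 (d b))" for b
      by (simp add: L_adjoint)
    then show "L V (-1) c = (\<Sum>b\<in>S \<inter> wt_space V k. B c (L V 1 (d b)) \<bullet> b)"
      using basis_expansion[OF dual w] by simp
    show "homogeneous_on (set as) (u(a' := d c, a := L V (-1) c))"
      using c w dual_weight[OF dual, of c "k - 1"] by (intro homogeneous_update2[OF hom']) auto
  qed
  also have "\<dots> = (\<Sum>c\<in>S \<inter> wt_space V (k - 1). pdiff a (Z (u(a' := d c, a := c)) as))"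
  proof (intro sum.cong refl)
    fix c assume "c \<in> S \<inter> wt_space V (k - 1)"
    then have "homogeneous_on (set as) (u(a' := d c, a := c))"
      using dual_weight[OF dual, of c "k - 1"] by (intro homogeneous_update2[OF hom']) auto
    from Z_translation[OF labels(1) this labels(2)]
    show "Z (u(a' := d c, a := L V (-1) c)) as = pdiff a (Z (u(a' := d c, a := c)) as)"
      by simp
  qed
  finally show ?thesis
    by (simp only: fun_upd_twist[OF labels(4)])
qed

end

end

section \<open>The partition function\<close>

text \<open>The order in which the insertion points occur in the definition of the partition function.\<close>

definition handle_labels :: "nat \<Rightarrow> int list" where
  "handle_labels g = concat (map (\<lambda>a. [a, - a]) [1..int g])"

lemma set_handle_labels: "set (handle_labels g) = index_set g"
proof (intro set_eqI iffI)
  fix a assume "a \<in> index_set g"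
  then have "\<bar>a\<bar> \<in> {1..int g}" "a \<in> {\<bar>a\<bar>, - \<bar>a\<bar>}"
    by (auto simp: index_set_def)
  then show "a \<in> set (handle_labels g)"
    unfolding handle_labels_def by auto
qed (auto simp: handle_labels_def index_set_def)

lemma distinct_handle_labels: "distinct (handle_labels g)"
proof -
  have "distinct (concat (map (\<lambda>a. [a, - a]) xs))" if "distinct xs" "\<forall>a\<in>set xs. a > 0" for xs :: "int list"
    using that by (induction xs) force+
  then show ?thesis
    unfolding handle_labels_def by simp
qed

definition handle_vectors :: "(int \<Rightarrow> 'v \<Rightarrow> 'v) \<Rightarrow> (int \<Rightarrow> 'v) \<Rightarrow> int \<Rightarrow> 'v" where
  "handle_vectors dual b a = (if a > 0 then b a else dual (- a) (b (- a)))"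

lemma handle_vectors_list:
  "concat (map (\<lambda>a. [(b a, a), (dual a (b a), - a)]) [1..int g]) =
   map (\<lambda>a. (handle_vectors dual b a, a)) (handle_labels g)"
  unfolding handle_labels_def map_concat map_map
  by (intro arg_cong[of _ _ concat] map_cong) (auto simp: handle_vectors_def)

lemma handle_vectors_update:
  assumes "c > 0"
  shows "handle_vectors dual (b(c := y)) = (handle_vectors dual b)(c := y, - c := dual c y)"
  using assms by (auto simp: handle_vectors_def fun_eq_iff)

lemma sum_PiE_insert:
  assumes "c \<notin> J"
  shows "sum f (PiE (insert c J) T) = (\<Sum>b\<in>PiE J T. \<Sum>y\<in>T c. f (b(c := y)))"
proof -
  have "sum f (PiE (insert c J) T) = (\<Sum>(y, b)\<in>T c \<times> PiE J T. f (b(c := y)))"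
    unfolding PiE_insert_eq using assms
    by (subst sum.reindex) (auto simp: inj_combinator comp_def case_prod_beta)
  also have "\<dots> = (\<Sum>y\<in>T c. \<Sum>b\<in>PiE J T. f (b(c := y)))"
    by (simp only: sum.cartesian_product)
  finally show ?thesis
    by (simp only: sum.swap[of _ "T c"])
qed

context voa_with_form
begin

context
  fixes basis :: "int \<Rightarrow> 'v set" and dual :: "int \<Rightarrow> 'v \<Rightarrow> 'v" and g :: nat
  assumes dual_bases: "\<And>a. a \<in> {1..int g} \<Longrightarrow> dual_bases (basis a) (dual a)"
begin

abbreviation choices :: "(int \<Rightarrow>\<^sub>0 nat) \<Rightarrow> (int \<Rightarrow> 'v) set" where
  "choices n \<equiv> \<Pi>\<^sub>E a\<in>{1..int g}. basis a \<inter> wt_space V (int (Poly_Mapping.lookup n a))"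

abbreviation Zh :: "(int \<Rightarrow> 'v) \<Rightarrow> ratfun" where
  "Zh u \<equiv> Z u (handle_labels g)"

abbreviation hv :: "(int \<Rightarrow> 'v) \<Rightarrow> int \<Rightarrow> 'v" where
  "hv \<equiv> handle_vectors dual"

abbreviation Z_V :: rho_series where
  "Z_V \<equiv> partition_function V B basis dual g"

lemma partition_function_eq:
  "Poly_Mapping.keys n \<subseteq> {1..int g} \<Longrightarrow> Z_V n = (\<Sum>b\<in>choices n. Zh (hv b))"
  by (simp add: partition_function_def Z_def handle_vectors_list)

lemma handle_vectors_weight:
  assumes "\<bar>a\<bar> \<in> {1..int g}" "b \<bar>a\<bar> \<in> basis \<bar>a\<bar> \<inter> wt_space V k"
  shows "hv b a \<in> wt_space V k"
proof (cases "a > 0")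
  case True
  then show ?thesis using assms by (simp add: handle_vectors_def)
next
  case False
  then have "\<bar>a\<bar> = - a" by simp
  then show ?thesis
    using False assms dual_weight[OF dual_bases, of "- a" "b (- a)" k] by (simp add: handle_vectors_def)
qed

text \<open>With the basis vectors of all other handles held fixed, this is the contraction lemma for the
  handle \<open>|a|\<close>; the weight drops by one there, which accounts for the factor \<open>\<rho>\<^sub>a\<close>.\<close>

lemma sum_L1_insertions:
  assumes n: "Poly_Mapping.keys n \<subseteq> {1..int g}" and a: "a \<in> index_set g"
  shows "(\<Sum>b\<in>choices n. Zh ((hv b)(a := L V 1 (hv b a)))) = times_rho a (partial_w (- a) Z_V) n"
proof -
  define c where "c = \<bar>a\<bar>"
  have c: "c \<in> {1..int g}" "c > 0" using a by (auto simp: c_def index_set_def)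
  have labels: "c \<in> set (handle_labels g)" "- c \<in> set (handle_labels g)" "a \<in> set (handle_labels g)"
    using c a by (auto simp: set_handle_labels index_set_def)
  let ?k = "int (Poly_Mapping.lookup n c)"
  show ?thesis
  proof (cases "Poly_Mapping.lookup n c = 0")
    case True
    \<comment> \<open>\<open>L(1)\<close> maps weight \<open>0\<close> to weight \<open>-1\<close>, and \<open>\<rho>\<^sub>a\<close> times a series has no constant term in \<open>\<rho>\<^sub>a\<close>.\<close>
    have "Zh ((hv b)(a := L V 1 (hv b a))) = 0" if "b \<in> choices n" for b
    proof -
      have "b c \<in> basis c \<inter> wt_space V ?k"
        using that c(1) by (rule PiE_mem)
      then have "hv b a \<in> wt_space V ?k"
        using c(1) unfolding c_def by (intro handle_vectors_weight)
      then have "L V 1 (hv b a) \<in> wt_space V (-1)"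
        using L_weight[of "hv b a" 0 1] True by simp
      then have "L V 1 (hv b a) = 0"
        using no_negative_weights[of "-1"] by simp
      then show ?thesis
        using Z_zero[OF distinct_handle_labels labels(3)] by simp
    qed
    then show ?thesis
      using True by (simp add: times_rho_def c_def)
  next
    case False
    define n' where "n' = n - Poly_Mapping.single c 1"
    have n'c: "int (Poly_Mapping.lookup n' c) = ?k - 1"
      using False by (simp add: n'_def lookup_minus lookup_single)
    have n'x: "Poly_Mapping.lookup n' x = Poly_Mapping.lookup n x" if "x \<noteq> c" for x
      using that by (simp add: n'_def lookup_minus lookup_single)
    have keys: "Poly_Mapping.keys n' \<subseteq> {1..int g}"
      using n by (auto simp: n'_def in_keys_iff lookup_minus)
    define J where "J = {1..int g} - {c}"
    have J: "{1..int g} = insert c J" "c \<notin> J"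
      using c by (auto simp: J_def)
    let ?T = "\<lambda>n x. basis x \<inter> wt_space V (int (Poly_Mapping.lookup n x))"
    have T: "PiE J (?T n') = PiE J (?T n)"
      using J(2) by (intro PiE_cong) (metis n'x)
    have split: "(\<Sum>b\<in>choices m. f (hv b)) =
        (\<Sum>b\<in>PiE J (?T m). \<Sum>y\<in>?T m c. f ((hv b)(c := y, - c := dual c y)))"
      for f :: "(int \<Rightarrow> 'v) \<Rightarrow> ratfun" and m
      unfolding J(1) sum_PiE_insert[OF J(2)] handle_vectors_update[OF c(2)] ..
    have "(\<Sum>y\<in>?T n c. Zh (((hv b)(c := y, - c := dual c y))(a := L V 1 (((hv b)(c := y, - c := dual c y)) a)))) =
        (\<Sum>y\<in>?T n' c. pdiff (- a) (Zh ((hv b)(c := y, - c := dual c y))))"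
      if b: "b \<in> PiE J (?T n)" for b
    proof -
      have hom: "homogeneous_on (set (handle_labels g) - {c, - c}) (hv b)"
        unfolding homogeneous_on_def
      proof
        fix x assume x: "x \<in> set (handle_labels g) - {c, - c}"
        then have "\<bar>x\<bar> \<in> J" "\<bar>x\<bar> \<in> {1..int g}"
          by (auto simp: set_handle_labels index_set_def J_def)
        then show "\<exists>h. hv b x \<in> wt_space V h"
          using handle_vectors_weight PiE_mem[OF b] by blast
      qed
      note con = dual_bases[OF c(1)] distinct_handle_labels labels(1,2) _ hom
      show ?thesis
      proof (cases "a > 0")
        case True
        then have "a = c" by (simp add: c_def)
        then show ?thesis
          using contract_L1_left[OF con, of ?k] c(2) n'c
          by (simp add: fun_upd_twist[of "- c" c])
      next
        case False
        then have "a = - c" by (simp add: c_def)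
        then show ?thesis
          using contract_L1_right[OF con, of ?k] c(2) n'c
          by simp
      qed
    qed
    then have "(\<Sum>b\<in>choices n. Zh ((hv b)(a := L V 1 (hv b a)))) =
        (\<Sum>b\<in>choices n'. pdiff (- a) (Zh (hv b)))"
      unfolding split[of "\<lambda>u. Zh (u(a := L V 1 (u a)))"] split[of "\<lambda>u. pdiff (- a) (Zh u)"] T
      by (rule sum.cong[OF refl])
    also have "\<dots> = pdiff (- a) (Z_V n')"
      by (simp only: partition_function_eq[OF keys] pdiff_sum)
    also have "\<dots> = times_rho a (partial_w (- a) Z_V) n"
      using False by (simp add: times_rho_def partial_w_def n'_def c_def)
    finally show ?thesis .
  qed
qed

lemma times_rho_partial_rho:
  "times_rho a (partial_rho a F) n = of_nat (Poly_Mapping.lookup n \<bar>a\<bar>) * F n"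
proof (cases "Poly_Mapping.lookup n \<bar>a\<bar> = 0")
  case False
  then have "n - Poly_Mapping.single \<bar>a\<bar> 1 + Poly_Mapping.single \<bar>a\<bar> 1 = n"
    by (intro poly_mapping_eqI) (auto simp: lookup_add lookup_minus lookup_single when_def)
  moreover have "Poly_Mapping.lookup (n - Poly_Mapping.single \<bar>a\<bar> 1) \<bar>a\<bar> + 1 = Poly_Mapping.lookup n \<bar>a\<bar>"
    using False by (simp add: lookup_minus)
  ultimately show ?thesis
    using False by (simp only: times_rho_def partial_rho_def if_False)
qed (simp add: times_rho_def)

theorem D_op_partition_function:
  assumes p: "degree p \<le> 2"
  shows "D_op g p Z_V n = 0"
proof (cases "Poly_Mapping.keys n \<subseteq> {1..int g}")
  case False
  \<comment> \<open>A variable other than \<open>\<rho>\<^sub>1, \<dots>, \<rho>\<^sub>g\<close> in a monomial survives division by \<open>\<rho>\<^sub>a\<close>.\<close>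
  then obtain x where x: "x \<notin> {1..int g}" "x \<in> Poly_Mapping.keys n" by blast
  have "Z_V n = 0"
    using False by (simp add: partition_function_def)
  moreover have "Z_V (n - Poly_Mapping.single \<bar>a\<bar> 1) = 0" if "a \<in> index_set g" for a
  proof -
    have "x \<noteq> \<bar>a\<bar>" using that x(1) by (auto simp: index_set_def)
    then have "x \<in> Poly_Mapping.keys (n - Poly_Mapping.single \<bar>a\<bar> 1)"
      using x(2) by (simp add: in_keys_iff lookup_minus lookup_single)
    then show ?thesis
      using x(1) unfolding partition_function_def by auto
  qed
  moreover have "pdiff a 0 = 0" for a
    using pdiff_sum[of a "\<lambda>_. 0" "{}"] by simp
  ultimately show ?thesis
    unfolding D_op_def times_rho_partial_rho
    by (intro sum.neutral) (auto simp: partial_w_def times_rho_def)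
next
  case True
  let ?h = "\<lambda>a. int (Poly_Mapping.lookup n \<bar>a\<bar>)"
  have ward: "(\<Sum>a\<in>index_set g. poly_at p a * pdiff a (Zh (hv b)) +
      poly_at (divided_deriv 1 p) a * (const (of_int (?h a)) * Zh (hv b)) +
      poly_at (divided_deriv 2 p) a * Zh ((hv b)(a := L V 1 (hv b a)))) = 0" if b: "b \<in> choices n" for b
    unfolding set_handle_labels[symmetric]
  proof (rule ward_identity[OF distinct_handle_labels _ p])
    fix a assume "a \<in> set (handle_labels g)"
    then have "\<bar>a\<bar> \<in> {1..int g}"
      by (auto simp: set_handle_labels index_set_def)
    then show "hv b a \<in> wt_space V (?h a)"
      using handle_vectors_weight PiE_mem[OF b] by blast
  qed
  have "D_op g p Z_V n = (\<Sum>a\<in>index_set g. \<Sum>b\<in>choices n. poly_at p a * pdiff a (Zh (hv b)) +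
      poly_at (divided_deriv 1 p) a * (const (of_int (?h a)) * Zh (hv b)) +
      poly_at (divided_deriv 2 p) a * Zh ((hv b)(a := L V 1 (hv b a))))"
    unfolding D_op_def times_rho_partial_rho partial_w_def[of _ _ n]
    by (intro sum.cong refl)
      (simp add: partition_function_eq[OF True] pdiff_sum sum_L1_insertions[OF True, symmetric]
        sum_distrib_left sum.distrib const_of_nat)
  also have "\<dots> = 0"
    by (subst sum.swap) (simp only: ward sum.neutral_const cong: sum.cong)
  finally show ?thesis .
qed

end

end

theorem proposition4p1:
  fixes V :: "('v :: ab_group_add) voa_data"
    and B :: "'v \<Rightarrow> 'v \<Rightarrow> complex"
    and g :: nat
    and basis :: "int \<Rightarrow> 'v set"
    and dual :: "int \<Rightarrow> 'v \<Rightarrow> 'v"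
    and p :: "complex poly"
  assumes "vertex_operator_algebra V"
    and "vertex_operator_algebra.simple V"
    and "vertex_operator_algebra.strong_CFT_type V"
    and "vertex_operator_algebra.self_contragredient V"
    and "vertex_operator_algebra.bilinear_form V B"
    and "nondegenerate B"
    and "vertex_operator_algebra.invariant V B"
    and "B (vac V) (vac V) = 1"
    and "g \<ge> 1"
    and "\<And>a. a \<in> {1..int g} \<Longrightarrow> vertex_operator_algebra.homogeneous_basis V (basis a)"
    and "\<And>a b c. a \<in> {1..int g} \<Longrightarrow> b \<in> basis a \<Longrightarrow> c \<in> basis a \<Longrightarrow>
           B b (dual a c) = (if b = c then 1 else 0)"
    and "degree p \<le> 2"
  shows "D_op g p (partition_function V B basis dual g) = (\<lambda>_. 0)"
proof
  fix n
  interpret vertex_operator_algebra V by (rule assms)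
  interpret voa_with_form V B
    using assms unfolding strong_CFT_type_def by unfold_locales auto
  have "dual_bases (basis a) (dual a)" if "a \<in> {1..int g}" for a
    using assms(10,11)[OF that] by (simp add: dual_bases_def)
  then show "D_op g p (partition_function V B basis dual g) n = 0"
    using assms by (intro D_op_partition_function)
qed

end
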